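(* Let $n\ge 1$ and $r\ge 1$ be integers. There exist functions $\mathrm{L}^r_i:\mathcal{P}(\mathbb{Z}^n)\to\mathbb{T}^r$ for $i=1,\dots,n+r$ such that $$\mathrm{L}^r(kP)=\sum_{i=1}^{n+r}\mathrm{L}^r_i(P)\,k^i$$ for every $k\in\mathbb{N}$ and $P\in\mathcal{P}(\mathbb{Z}^n)$. For each $i$, the function $\mathrm{L}^r_i$ is an $\mathrm{SL}_n(\mathbb{Z})$ equivariant, translation covariant and $i$-homogeneous valuation.
   Context: $\mathbb{N}$ is the set of non-negative integers. $\mathcal{P}(\mathbb{Z}^n)$ is the set of lattice polytopes in $\mathbb{R}^n$, i.e. convex polytopes with vertices in $\mathbb{Z}^n$ (the empty set is included). $\mathbb{T}^r$ is the vector space of symmetric tensors of rank $r$ on $\mathbb{R}^n$, identified via the scalar product with symmetric $r$-linear functionals on $(\mathbb{R}^n)^r$; $\mathbb{T}^0=\mathbb{R}$. For $x\in\mathbb{R}^n$, $x^r\in\mathbb{T}^r$ is the $r$-fold symmetric tensor product, $x^r(v_1,\dots,v_r)=(x\cdot v_1)\cdots(x\cdot v_r)$, and $x^0=1$. Products of symmetric tensors are symmetric tensor products: for $A\in\mathbb{T}^{p}$, $B\in\mathbb{T}^{q}$, $(AB)(v_1,\dots,v_{p+q})=\frac{1}{(p+q)!}\sum_\sigma A(v_{\sigma(1)},\dots,v_{\sigma(p)})B(v_{\sigma(p+1)},\dots,v_{\sigma(p+q)})$, summing over all permutations $\sigma$ of $1,\dots,p+q$. The discrete moment tensor of rank $r$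 is $\mathrm{L}^r(P)=\frac1{r!}\sum_{x\in P\cap\mathbb{Z}^n}x^r$. A function $\mathrm{Z}:\mathcal{P}(\mathbb{Z}^n)\to\mathbb{T}^r$ is: a valuation if $\mathrm{Z}(\emptyset)=0$ and $\mathrm{Z}(P)+\mathrm{Z}(Q)=\mathrm{Z}(P\cup Q)+\mathrm{Z}(P\cap Q)$ whenever $P,Q,P\cup Q,P\cap Q\in\mathcal{P}(\mathbb{Z}^n)$; $\mathrm{SL}_n(\mathbb{Z})$ equivariant if $\mathrm{Z}(\phi P)(v_1,\dots,v_r)=\mathrm{Z}(P)(\phi^t v_1,\dots,\phi^t v_r)$ for all $v_1,\dots,v_r\in\mathbb{R}^n$, $\phi\in\mathrm{SL}_n(\mathbb{Z})$ (integer matrices of determinant $1$), $P\in\mathcal{P}(\mathbb{Z}^n)$, where $\phi^t$ is the transpose; $i$-homogeneous if $\mathrm{Z}(kP)=k^i\mathrm{Z}(P)$ for all $k\in\mathbb{N}$ and $P\in\mathcal{P}(\mathbb{Z}^n)$. A valuation $\mathrm{Z}:\mathcal{P}(\mathbb{Z}^n)\to\mathbb{T}^r$ is translation covariant if there are functions $\mathrm{Z}^j:\mathcal{P}(\mathbb{Z}^n)\to\mathbb{T}^j$, $j=0,\dots,r$, such that $\mathrm{Z}(P+y)=\sum_{j=0}^r\mathrm{Z}^{r-j}(P)\frac{y^j}{j!}$ for all $y\in\mathbb{Z}^n$ and $P\in\mathcal{P}(\mathbb{Z}^n)$. *)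

theory Defs
  imports "HOL-Analysis.Analysis" "HOL-Combinatorics.Permutations"
begin

definition int_lattice :: "(real^'n) set" where
  "int_lattice = {x. \<forall>i. x $ i \<in> \<int>}"

definition lattice_polytopes :: "(real^'n) set set" where
  "lattice_polytopes = {P. polytope P \<and> {x. x extreme_point_of P} \<subseteq> int_lattice}"

text \<open>
  A tensor is applied to a sequence of vectors \<open>v 0, v 1, \<dots>\<close>. A tensor of rank \<open>r\<close> may depend
  only on \<open>v 0, \<dots>, v (r - 1)\<close>, so two tensors of rank \<open>r\<close> are equal iff they are equal
  as HOL functions, and tensors of rank 0 are the constant functions.
\<close>

type_synonym 'n tensor = "(nat \<Rightarrow> real^'n) \<Rightarrow> real"

definition sym_tensors :: "nat \<Rightarrow> 'n::finite tensor set" where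
  "sym_tensors r = {A.
     (\<forall>v w. (\<forall>i<r. v i = w i) \<longrightarrow> A v = A w) \<and>
     (\<forall>v. \<forall>i<r. linear (\<lambda>x. A (v(i := x)))) \<and>
     (\<forall>v \<sigma>. \<sigma> permutes {..<r} \<longrightarrow> A (v \<circ> \<sigma>) = A v)}"

definition tensor_power :: "real^'n \<Rightarrow> nat \<Rightarrow> 'n::finite tensor" where
  "tensor_power x r v = (\<Prod>i<r. x \<bullet> v i)"

text \<open>The ranks \<open>p\<close> and \<open>q\<close> of the factors have to be passed explicitly.\<close>

definition sym_product :: "nat \<Rightarrow> nat \<Rightarrow> 'n tensor \<Rightarrow> 'n tensor \<Rightarrow> 'n::finite tensor" where
  "sym_product p q A B v =
     (\<Sum>\<sigma> | \<sigma> permutes {..<p + q}. A (\<lambda>i. v (\<sigma> i)) * B (\<lambda>i. v (\<sigma> (p + i)))) / fact (p + q)"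

definition discrete_moment :: "nat \<Rightarrow> (real^'n) set \<Rightarrow> 'n::finite tensor" where
  "discrete_moment r P v = (\<Sum>x\<in>P \<inter> int_lattice. tensor_power x r v) / fact r"

definition dilate :: "nat \<Rightarrow> (real^'n) set \<Rightarrow> (real^'n) set" where
  "dilate k P = (\<lambda>x. real k *\<^sub>R x) ` P"

definition SL_int :: "(real^'n^'n) set" where
  "SL_int = {\<phi>. (\<forall>i j. \<phi> $ i $ j \<in> \<int>) \<and> det \<phi> = 1}"

definition valuation :: "((real^'n) set \<Rightarrow> 'n::finite tensor) \<Rightarrow> bool" where
  "valuation Z \<longleftrightarrow>
     (\<forall>v. Z {} v = 0) \<and>
     (\<forall>P Q. P \<in> lattice_polytopes \<longrightarrow> Q \<in> lattice_polytopes \<longrightarrow>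
        P \<union> Q \<in> lattice_polytopes \<longrightarrow> P \<inter> Q \<in> lattice_polytopes \<longrightarrow>
        (\<forall>v. Z P v + Z Q v = Z (P \<union> Q) v + Z (P \<inter> Q) v))"

definition SL_equivariant :: "((real^'n) set \<Rightarrow> 'n::finite tensor) \<Rightarrow> bool" where
  "SL_equivariant Z \<longleftrightarrow>
     (\<forall>\<phi>\<in>SL_int. \<forall>P\<in>lattice_polytopes. \<forall>v.
        Z ((\<lambda>x. \<phi> *v x) ` P) v = Z P (\<lambda>i. transpose \<phi> *v v i))"

definition homogeneous :: "nat \<Rightarrow> ((real^'n) set \<Rightarrow> 'n::finite tensor) \<Rightarrow> bool" where
  "homogeneous i Z \<longleftrightarrow>
     (\<forall>k. \<forall>P\<in>lattice_polytopes. \<forall>v. Z (dilate k P) v = real k ^ i * Z P v)"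

definition translation_covariant :: "nat \<Rightarrow> ((real^'n) set \<Rightarrow> 'n::finite tensor) \<Rightarrow> bool" where
  "translation_covariant r Z \<longleftrightarrow>
     (\<exists>Y :: nat \<Rightarrow> (real^'n) set \<Rightarrow> 'n tensor.
        (\<forall>j\<le>r. Y j \<in> lattice_polytopes \<rightarrow> sym_tensors j) \<and>
        (\<forall>y\<in>int_lattice. \<forall>P\<in>lattice_polytopes. \<forall>v.
           Z ((\<lambda>x. x + y) ` P) v =
             (\<Sum>j\<le>r. sym_product (r - j) j (Y (r - j) P) (tensor_power y j) v / fact j)))"

end

theory Submission
  imports Defs "HOL-Computational_Algebra.Polynomial_FPS"
begin

text \<open>
  The theorem is the Ehrhart theorem for the weight \<open>x \<mapsto> x\<^sup>r\<close>: the sum of \<open>x\<^sup>r\<close> over the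
  lattice points of \<open>k P\<close> is a polynomial in \<open>k\<close>. Once this is known, \<open>L\<^sub>i\<close> is the coefficient of
  \<open>k\<^sup>i\<close>, and each property of \<open>L\<^sub>i\<close> follows from the corresponding property of the discrete
  moment tensor of \<open>k P\<close>, because a polynomial is determined by its values at the positive integers
  (\<open>ehrhart_polynomial_eqI\<close>). Translation covariance is the binomial theorem for \<open>(x + k y)\<^sup>r\<close>
  (\<open>tensor_power_add\<close>): the factor \<open>(k y)\<^sup>j\<close> lowers the exponent by \<open>j\<close>, so the associated
  function of rank \<open>r - j\<close> is the coefficient of \<open>k\<^bsup>i - j\<^esup>\<close> in the polynomial of that rank.

  Polynomiality (\<open>lattice_polytope_moment_polynomial\<close>) is proved without the face structure of \<open>P\<close>.
  List the vertices of \<open>P\<close>. A point of \<open>k P\<close> has many representations as a combination of vertices with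
  nonnegative weights of total \<open>k\<close>; choose the lexicographically least one. Its support is affinely
  independent (otherwise an affine dependence could be used to decrease the weights), and whether
  weights are least depends on their support alone (\<open>lex_minimal_face\<close>). Hence \<open>k P\<close> is the
  disjoint union of the relatively open simplices \<open>k T\<close>, where \<open>T\<close> ranges over a family of
  affinely independent sets of vertices that does not depend on \<open>k\<close>.

  The sum over an open simplex is an alternating sum over its closed faces, so closed simplices
  suffice. There, weights of a lattice point split uniquely into fractional parts, which range over a
  finite set, and natural numbers with prescribed sum (\<open>sum_lattice_weights_eq\<close>). The generating function
  of the resulting sums is \<open>X\<^sup>h A / (1 - X)\<^bsup>r + s\<^esup>\<close> with \<open>s\<close> vertices, \<open>deg A \<le> r\<close> and, since
  \<open>h\<close> is a sum of \<open>s\<close> numbers less than 1, \<open>h < s\<close>. So the numerator has smaller degree than the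
  denominator, and the coefficients are a polynomial of degree at most \<open>r + s - 1\<close> for all
  \<open>k \<ge> 0\<close>, where \<open>s \<le> n + 1\<close>.

  Among the open simplices is the empty one, which counts the single point \<open>0\<close> of \<open>0 P\<close>. It
  contributes at \<open>k = 0\<close> only, and this is not polynomial. For \<open>r \<ge> 1\<close> it is harmless, as
  \<open>0\<^sup>r = 0\<close>; for \<open>r = 0\<close>, which enters through translation covariance, the values at
  \<open>k \<ge> 1\<close> suffice. This is why the domain \<open>{k. 1 \<le> k \<or> 1 \<le> r}\<close> appears below.
\<close>

section \<open>Generating functions of polynomial sequences\<close>

lemma degree_backward_difference:
  fixes q :: "real poly"
  assumes "degree q \<le> Suc d"
  shows "degree (q - pcompose q [:-1, 1:]) \<le> d"
proof (rule degree_le, intro allI impI)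
  fix i assume "d < i"
  let ?q = "pcompose q [:-1, 1:]"
  have deg: "degree ?q = degree q" by (simp add: degree_pcompose)
  have lead: "coeff ?q (degree q) = coeff q (degree q)"
    using lead_coeff_comp[of "[:-1, 1:]" q] deg by simp
  show "coeff (q - ?q) i = 0"
  proof (cases "i = degree q")
    case True
    then show ?thesis using lead by simp
  next
    case False
    then have "i > degree q" using \<open>d < i\<close> assms by linarith
    then show ?thesis using deg by (simp add: coeff_eq_0)
  qed
qed

text \<open>
  Multiplication by \<open>1 - X\<close> replaces a sequence by its backward difference, which lowers the degree of
  a polynomial sequence. The difference at 0 sees 0 instead of \<open>q (-1)\<close> as the preceding
  value; this accounts for the constant \<open>q (-1)\<close> in the numerator.
\<close>

lemma polynomial_sequence_fps:
  fixes q :: "real poly"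
  assumes "degree q \<le> d"
  shows "\<exists>a. degree a \<le> d \<and>
    Abs_fps (\<lambda>k. poly q (real k)) * (1 - fps_X) ^ Suc d = fps_of_poly a"
  using assms
proof (induction d arbitrary: q)
  case 0
  then obtain c where q: "q = [:c:]" by (meson degree_eq_zeroE le_zero_eq)
  have "Abs_fps (\<lambda>k. poly q (real k)) * (1 - fps_X) = fps_of_poly [:c:]"
    by (rule fps_ext) (simp add: q algebra_simps fps_of_poly_nth coeff_pCons split: nat.split)
  then show ?case by (intro exI[of _ "[:c:]"]) simp
next
  case (Suc d)
  let ?\<Delta> = "q - pcompose q [:-1, 1:]"
  obtain a where a: "degree a \<le> d"
    "Abs_fps (\<lambda>k. poly ?\<Delta> (real k)) * (1 - fps_X) ^ Suc d = fps_of_poly a"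
    using Suc.IH[OF degree_backward_difference[OF Suc.prems]] by blast
  have step: "Abs_fps (\<lambda>k. poly q (real k)) * (1 - fps_X) =
      fps_const (poly q (-1)) + Abs_fps (\<lambda>k. poly ?\<Delta> (real k))"
  proof (rule fps_ext)
    fix k
    show "fps_nth (Abs_fps (\<lambda>k. poly q (real k)) * (1 - fps_X)) k =
      fps_nth (fps_const (poly q (-1)) + Abs_fps (\<lambda>k. poly ?\<Delta> (real k))) k"
      by (cases k) (simp_all add: algebra_simps poly_pcompose)
  qed
  let ?b = "smult (poly q (-1)) ([:1, -1:] ^ Suc d) + a"
  have one: "fps_of_poly [:1, -1:] = (1 - fps_X :: real fps)"
    by (simp add: fps_of_poly_pCons)
  have "Abs_fps (\<lambda>k. poly q (real k)) * (1 - fps_X) ^ Suc (Suc d) =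
      (fps_const (poly q (-1)) + Abs_fps (\<lambda>k. poly ?\<Delta> (real k))) * (1 - fps_X) ^ Suc d"
    by (subst step[symmetric]) (simp add: mult.assoc)
  also have "\<dots> = fps_of_poly ?b"
    using a(2) by (simp add: distrib_right fps_of_poly_add fps_of_poly_smult fps_of_poly_mult fps_of_poly_power one
       del: power_Suc mult_pCons_left)
  finally have "Abs_fps (\<lambda>k. poly q (real k)) * (1 - fps_X) ^ Suc (Suc d) = fps_of_poly ?b" .
  moreover have "degree ([:1, -1:] ^ Suc d :: real poly) \<le> Suc d"
    by (rule order_trans[OF degree_power_le]) simp
  then have "degree ?b \<le> Suc d"
    using a(1) by (intro degree_add_le order_trans[OF degree_smult_le]) auto
  ultimately show ?case by blast
qed

lemma binomial_sequence_fps: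
  "Abs_fps (\<lambda>k. real ((k + d) choose d)) * (1 - fps_X) ^ Suc d = 1"
proof (induction d)
  case 0
  show ?case
    by (rule fps_ext) (simp add: algebra_simps)
next
  case (Suc d)
  have "Abs_fps (\<lambda>k. real ((k + Suc d) choose Suc d)) * (1 - fps_X) =
     Abs_fps (\<lambda>k. real ((k + d) choose d))"
  proof (rule fps_ext)
    fix k
    show "fps_nth (Abs_fps (\<lambda>k. real ((k + Suc d) choose Suc d)) * (1 - fps_X)) k =
       fps_nth (Abs_fps (\<lambda>k. real ((k + d) choose d))) k"
      by (cases k) (simp_all add: algebra_simps)
  qed
  then show ?case using Suc by (simp add: mult.assoc[symmetric])
qed

lemma binomial_sequence_polynomial:
  "\<exists>q::real poly. degree q \<le> d \<and> (\<forall>k. real ((k + d) choose d) = poly q (real k))"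
proof (induction d)
  case 0
  show ?case by (intro exI[of _ 1]) simp
next
  case (Suc d)
  then obtain q :: "real poly" where q: "degree q \<le> d" "\<And>k. real ((k + d) choose d) = poly q (real k)"
    by blast
  let ?l = "[:1, 1 / real (Suc d):]"
  have "real ((k + Suc d) choose Suc d) = poly (q * ?l) (real k)" for k
  proof -
    have "real (Suc d) * real ((k + Suc d) choose Suc d) = real (Suc (k + d)) * real ((k + d) choose d)"
      by (metis Suc_times_binomial_eq add_Suc_right of_nat_mult mult.commute)
    then show ?thesis
      by (simp add: q(2)[symmetric] field_simps)
  qed
  moreover have "degree (q * ?l) \<le> Suc d"
    using q(1) by (intro order_trans[OF degree_mult_le]) simp
  ultimately show ?case by blast
qed

text \<open>
  Converse of \<open>polynomial_sequence_fps\<close>. Writing \<open>a = a(1) + (1 - X) b\<close> splits off a multiple of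
  \<open>1 / (1 - X)\<^bsup>d + 1\<^esup>\<close>, whose coefficients are binomial coefficients, and leaves
  \<open>b / (1 - X)\<^sup>d\<close>.
\<close>

lemma fps_polynomial_sequence:
  fixes F :: "real fps"
  assumes "degree a \<le> d" "F * (1 - fps_X) ^ Suc d = fps_of_poly a"
  shows "\<exists>q. degree q \<le> d \<and> (\<forall>k. fps_nth F k = poly q (real k))"
  using assms
proof (induction d arbitrary: a F)
  case 0
  then obtain c where a: "a = [:c:]" by (meson degree_eq_zeroE le_zero_eq)
  have E: "F * (1 - fps_X) = fps_const c" using 0(2) a by (simp add: fps_of_poly_pCons)
  have "fps_nth F k = c" for k
  proof (induction k)
    case 0
    show ?case using arg_cong[OF E, of "\<lambda>f. fps_nth f 0"] by simp
  next
    case (Suc k)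
    then show ?case using arg_cong[OF E, of "\<lambda>f. fps_nth f (Suc k)"] by (simp add: algebra_simps)
  qed
  then show ?case by (intro exI[of _ "[:c:]"]) simp
next
  case (Suc d)
  define c where "c = poly a 1"
  have "[:-1, 1:] dvd a - [:c:]"
    using poly_eq_0_iff_dvd[of "a - [:c:]" 1] by (simp add: c_def)
  then obtain b' where b': "a - [:c:] = [:-1, 1:] * b'" by blast
  define b where "b = - b'"
  have ab: "a = [:c:] + [:1, -1:] * b" using b' by (simp add: b_def algebra_simps)
  have degb: "degree b \<le> d"
  proof (cases "b = 0")
    case False
    have "degree ([:1, -1:] * b) = Suc (degree b)"
      using False by (subst degree_mult_eq) auto
    moreover have "degree ([:1, -1:] * b) \<le> Suc d"
    proof -
      have "[:1, -1:] * b = a - [:c:]" using ab by simp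
      then show ?thesis using Suc.prems(1) by (metis degree_diff_le degree_pCons_0 le0)
    qed
    ultimately show ?thesis by simp
  qed simp
  have one: "fps_of_poly [:1, -1:] = (1 - fps_X :: real fps)"
    by (simp add: fps_of_poly_pCons)
  let ?B = "Abs_fps (\<lambda>k. real ((k + Suc d) choose Suc d))"
  define G where "G = F - fps_const c * ?B"
  have "G * (1 - fps_X) ^ Suc (Suc d) =
     fps_of_poly a - fps_const c * (?B * (1 - fps_X) ^ Suc (Suc d))"
    unfolding G_def Suc.prems(2)[symmetric] by (simp only: left_diff_distrib mult.assoc)
  also have "\<dots> = fps_of_poly ([:1, -1:] * b)"
    unfolding binomial_sequence_fps ab fps_of_poly_add by (simp add: fps_of_poly_pCons)
  also have "\<dots> = (1 - fps_X) * fps_of_poly b"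
    by (simp only: fps_of_poly_mult one)
  finally have "(1 - fps_X) * (G * (1 - fps_X) ^ Suc d) = (1 - fps_X) * fps_of_poly b"
    by (simp add: algebra_simps)
  moreover have "(1 - fps_X :: real fps) \<noteq> 0"
    by (metis diff_self fps_X_neq_one right_minus_eq)
  ultimately have "G * (1 - fps_X) ^ Suc d = fps_of_poly b"
    by (metis mult_left_cancel)
  from Suc.IH[OF degb this] obtain q where q: "degree q \<le> d" "\<And>k. fps_nth G k = poly q (real k)"
    by blast
  obtain p :: "real poly" where p: "degree p \<le> Suc d"
     "\<And>k. real ((k + Suc d) choose Suc d) = poly p (real k)"
    using binomial_sequence_polynomial by blast
  have "fps_nth F k = poly (q + smult c p) (real k)" for k
    using q(2)[of k] p(2)[of k] by (simp add: G_def)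
  moreover have "degree (q + smult c p) \<le> Suc d"
    using q(1) p(1) by (intro degree_add_le order_trans[OF degree_smult_le]) auto
  ultimately show ?case by blast
qed

definition compositions :: "'a set \<Rightarrow> nat \<Rightarrow> ('a \<Rightarrow> nat) set" where
  "compositions S N = {m. (\<forall>v. v \<notin> S \<longrightarrow> m v = 0) \<and> sum m S = N}"

lemma finite_compositions:
  assumes "finite S"
  shows "finite (compositions S N)"
proof (rule finite_subset)
  show "compositions S N \<subseteq> {m. \<forall>v. (v \<in> S \<longrightarrow> m v \<in> {..N}) \<and> (v \<notin> S \<longrightarrow> m v = 0)}"
    using assms by (auto simp: compositions_def intro: member_le_sum)
  show "finite {m. \<forall>v. (v \<in> S \<longrightarrow> m v \<in> {..N}) \<and> (v \<notin> S \<longrightarrow> m v = 0)}"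
    using assms by (intro finite_set_of_finite_funs) auto
qed

lemma sum_compositions_eq_fps_nth:
  fixes a :: "'a \<Rightarrow> nat \<Rightarrow> real"
  assumes "finite S"
  shows "(\<Sum>m\<in>compositions S N. \<Prod>v\<in>S. a v (m v)) = fps_nth (\<Prod>v\<in>S. Abs_fps (a v)) N"
  using assms
proof (induction S arbitrary: N)
  case empty
  have "compositions ({} :: 'a set) N = (if N = 0 then {\<lambda>_. 0} else {})"
    by (auto simp: compositions_def)
  then show ?case by simp
next
  case (insert x S)
  have "fps_nth (\<Prod>v\<in>insert x S. Abs_fps (a v)) N =
      (\<Sum>j\<in>{0..N}. \<Sum>m\<in>compositions S (N - j). a x j * (\<Prod>v\<in>S. a v (m v)))"
    using insert by (simp add: fps_mult_nth insert.IH[symmetric] sum_distrib_left)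
  also have "\<dots> = (\<Sum>(j,m)\<in>Sigma {0..N} (\<lambda>j. compositions S (N - j)). a x j * (\<Prod>v\<in>S. a v (m v)))"
    using finite_compositions[OF insert.hyps(1)] by (intro sum.Sigma) auto
  also have "\<dots> = (\<Sum>m\<in>compositions (insert x S) N. \<Prod>v\<in>insert x S. a v (m v))"
  proof (rule sum.reindex_bij_witness[where i = "\<lambda>m. (m x, m(x := 0))" and j = "\<lambda>(j, m). m(x := j)"])
    fix jm assume jm: "jm \<in> Sigma {0..N} (\<lambda>j. compositions S (N - j))"
    obtain j m where [simp]: "jm = (j, m)" by force
    have m: "j \<le> N" "\<And>v. v \<notin> S \<Longrightarrow> m v = 0" "sum m S = N - j"
      using jm by (auto simp: compositions_def)
    have upd: "sum (m(x := j)) S = sum m S" "(\<Prod>v\<in>S. a v ((m(x := j)) v)) = (\<Prod>v\<in>S. a v (m v))"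
      using insert.hyps by (auto intro!: sum.cong prod.cong)
    show "(\<lambda>m. (m x, m(x := 0))) ((\<lambda>(j, m). m(x := j)) jm) = jm"
      using m(2)[OF insert.hyps(2)] by (auto simp: fun_eq_iff)
    show "(\<lambda>(j, m). m(x := j)) jm \<in> compositions (insert x S) N"
      using m upd insert.hyps by (auto simp: compositions_def)
    show "(\<Prod>v\<in>insert x S. a v ((\<lambda>(j, m). m(x := j)) jm v)) =
        (case jm of (j, m) \<Rightarrow> a x j * (\<Prod>v\<in>S. a v (m v)))"
      using upd insert.hyps by simp
  next
    fix m assume m: "m \<in> compositions (insert x S) N"
    show "(\<lambda>(j, m). m(x := j)) (m x, m(x := 0)) = m" by simp
    have "sum (m(x := 0)) S = sum m S"
      using insert.hyps by (auto intro!: sum.cong)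
    then show "(m x, m(x := 0)) \<in> Sigma {0..N} (\<lambda>j. compositions S (N - j))"
      using m insert.hyps by (auto simp: compositions_def)
  qed
  finally show ?case by simp
qed

text \<open>
  The sum is the coefficient of \<open>X\<^sup>k\<close> in \<open>X\<^sup>h\<close> times a product of one generating function per element of
  \<open>S\<close>. The condition \<open>h < card S\<close> keeps the degree of the numerator below that of the denominator, so that the
  polynomial describes the sum from \<open>k = 0\<close> on, including the range \<open>k < h\<close> where the sum is empty.
\<close>

lemma sum_compositions_polynomial:
  fixes q :: "'a \<Rightarrow> real poly"
  assumes "finite S" and h: "h < card S" and deg: "\<And>v. v \<in> S \<Longrightarrow> degree (q v) \<le> d v"
  shows "\<exists>p. degree p \<le> sum d S + card S - 1 \<and>
     (\<forall>k. (\<Sum>m | m \<in> compositions S (k - h) \<and> h \<le> k. \<Prod>v\<in>S. poly (q v) (real (m v))) = poly p (real k))"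
proof -
  have "\<forall>v\<in>S. \<exists>a. degree a \<le> d v \<and>
      Abs_fps (\<lambda>k. poly (q v) (real k)) * (1 - fps_X) ^ Suc (d v) = fps_of_poly a"
    using polynomial_sequence_fps deg by blast
  then obtain a where a: "\<And>v. v \<in> S \<Longrightarrow> degree (a v) \<le> d v"
      "\<And>v. v \<in> S \<Longrightarrow> Abs_fps (\<lambda>k. poly (q v) (real k)) * (1 - fps_X) ^ Suc (d v) = fps_of_poly (a v)"
    by metis
  define G where "G = (\<Prod>v\<in>S. Abs_fps (\<lambda>k. poly (q v) (real k)))"
  let ?D = "sum d S + card S - 1"
  have D: "Suc ?D = (\<Sum>v\<in>S. Suc (d v))" using h by (simp add: sum.distrib sum_Suc)
  let ?A = "monom 1 h * (\<Prod>v\<in>S. a v)"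
  have "fps_X ^ h * G * (1 - fps_X) ^ Suc ?D = fps_of_poly ?A"
    unfolding D power_sum G_def mult.assoc prod.distrib[symmetric]
    using a(2) by (simp add: fps_of_poly_mult fps_of_poly_prod fps_of_poly_monom del: power_Suc)
  moreover have "degree ?A \<le> ?D"
  proof -
    have "degree (\<Prod>v\<in>S. a v) \<le> sum d S"
      using degree_prod_sum_le[OF assms(1), of a] sum_mono[of S "degree \<circ> a" d] a(1) by fastforce
    then have "degree ?A \<le> h + sum d S"
      by (intro order_trans[OF degree_mult_le] add_mono) (auto simp: degree_monom_le)
    then show ?thesis using h by simp
  qed
  ultimately obtain p where p: "degree p \<le> ?D" "\<And>k. fps_nth (fps_X ^ h * G) k = poly p (real k)"
    using fps_polynomial_sequence by blast
  have "(\<Sum>m | m \<in> compositions S (k - h) \<and> h \<le> k. \<Prod>v\<in>S. poly (q v) (real (m v))) = poly p (real k)" for k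
  proof (cases "h \<le> k")
    case True
    then have "(\<Sum>m | m \<in> compositions S (k - h) \<and> h \<le> k. \<Prod>v\<in>S. poly (q v) (real (m v))) = fps_nth G (k - h)"
      using sum_compositions_eq_fps_nth[OF assms(1), of "\<lambda>v k. poly (q v) (real k)" "k - h"] by (simp add: G_def)
    then show ?thesis using True p(2)[of k] by (simp add: fps_X_power_mult_nth)
  next
    case False
    then show ?thesis using p(2)[of k] by (simp add: fps_X_power_mult_nth)
  qed
  then show ?thesis using p(1) by blast
qed

section \<open>Triangulating a point configuration by lexicographically minimal weights\<close>

definition weights :: "'a set \<Rightarrow> ('a \<Rightarrow> real) set" where
  "weights V = {\<alpha>. (\<forall>v. 0 \<le> \<alpha> v) \<and> (\<forall>v. v \<notin> V \<longrightarrow> \<alpha> v = 0)}"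

definition combination :: "'a set \<Rightarrow> ('a \<Rightarrow> real) \<Rightarrow> 'a::real_vector" where
  "combination V \<alpha> = (\<Sum>v\<in>V. \<alpha> v *\<^sub>R v)"

definition supp :: "('a \<Rightarrow> real) \<Rightarrow> 'a set" where
  "supp \<alpha> = {v. \<alpha> v \<noteq> 0}"

text \<open>
  The first nonzero entry along the list is negative: \<open>\<mu>\<close> precedes \<open>\<alpha>\<close> lexicographically iff
  \<open>\<mu> - \<alpha>\<close> has this property. Formulated for differences, the order is compatible with sums and
  positive multiples.
\<close>

fun lex_negative :: "'a list \<Rightarrow> ('a \<Rightarrow> real) \<Rightarrow> bool" where
  "lex_negative [] d \<longleftrightarrow> False"
| "lex_negative (v # vs) d \<longleftrightarrow> d v < 0 \<or> d v = 0 \<and> lex_negative vs d"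

definition lex_minimal :: "'a::real_vector list \<Rightarrow> ('a \<Rightarrow> real) \<Rightarrow> bool" where
  "lex_minimal vs \<alpha> \<longleftrightarrow> \<alpha> \<in> weights (set vs) \<and>
     (\<forall>\<mu>\<in>weights (set vs). sum \<mu> (set vs) = sum \<alpha> (set vs) \<longrightarrow>
        combination (set vs) \<mu> = combination (set vs) \<alpha> \<longrightarrow> \<not> lex_negative vs (\<lambda>v. \<mu> v - \<alpha> v))"

lemma in_supp: "v \<in> supp \<alpha> \<longleftrightarrow> \<alpha> v \<noteq> 0"
  by (simp add: supp_def)

lemma weights_nonneg: "\<alpha> \<in> weights V \<Longrightarrow> 0 \<le> \<alpha> v"
  by (simp add: weights_def)

lemma weights_supp: "\<alpha> \<in> weights V \<longleftrightarrow> (\<forall>v. 0 \<le> \<alpha> v) \<and> supp \<alpha> \<subseteq> V"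
  by (auto simp: weights_def supp_def)

lemma combination_add: "combination V (\<lambda>v. \<alpha> v + \<mu> v) = combination V \<alpha> + combination V \<mu>"
  by (simp add: combination_def scaleR_add_left sum.distrib)

lemma combination_diff: "combination V (\<lambda>v. \<alpha> v - \<mu> v) = combination V \<alpha> - combination V \<mu>"
  by (simp add: combination_def scaleR_diff_left sum_subtractf)

lemma combination_scale: "combination V (\<lambda>v. c * \<alpha> v) = c *\<^sub>R combination V \<alpha>"
  by (simp add: combination_def scaleR_sum_right)

lemma combination_mono_neutral:
  assumes "finite V" "T \<subseteq> V" "supp \<alpha> \<subseteq> T"
  shows "combination V \<alpha> = combination T \<alpha>" "sum \<alpha> V = sum \<alpha> T"
  using assms unfolding combination_def supp_def by (auto intro!: sum.mono_neutral_right)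

lemma lex_negative_scale: "0 < c \<Longrightarrow> lex_negative vs (\<lambda>v. c * d v) = lex_negative vs d"
  by (induction vs) (auto simp: mult_less_0_iff)

lemma lex_negative_add:
  "lex_negative vs d \<Longrightarrow> lex_negative vs e \<Longrightarrow> lex_negative vs (\<lambda>v. d v + e v)"
  by (induction vs) auto

lemma lex_negative_total:
  "lex_negative vs d \<or> lex_negative vs (\<lambda>v. - d v) \<or> (\<forall>v\<in>set vs. d v = 0)"
  by (induction vs) auto

lemma lex_negative_irrefl: "(\<And>v. d v = 0) \<Longrightarrow> \<not> lex_negative vs d"
  by (induction vs) auto

lemma lex_minimal_unique:
  assumes "lex_minimal vs \<alpha>" "lex_minimal vs \<mu>" "sum \<alpha> (set vs) = sum \<mu> (set vs)"
    "combination (set vs) \<alpha> = combination (set vs) \<mu>"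
  shows "\<alpha> = \<mu>"
proof
  fix v
  have "\<not> lex_negative vs (\<lambda>v. \<alpha> v - \<mu> v)" "\<not> lex_negative vs (\<lambda>v. \<mu> v - \<alpha> v)"
    using assms by (auto simp: lex_minimal_def)
  then have "\<forall>v\<in>set vs. \<alpha> v - \<mu> v = 0"
    using lex_negative_total[of vs "\<lambda>v. \<alpha> v - \<mu> v"] by simp
  moreover have "v \<notin> set vs \<Longrightarrow> \<alpha> v = 0 \<and> \<mu> v = 0"
    using assms(1,2) by (simp add: lex_minimal_def weights_def)
  ultimately show "\<alpha> v = \<mu> v" by fastforce
qed

lemma small_multiple_below:
  fixes a b :: "'a \<Rightarrow> real"
  assumes "finite S" "\<And>v. v \<in> S \<Longrightarrow> 0 < a v"
  shows "\<exists>\<epsilon>>0. \<forall>v\<in>S. \<epsilon> * b v \<le> a v"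
  using assms
proof (induction S)
  case empty
  show ?case by (intro exI[of _ 1]) simp
next
  case (insert x S)
  then obtain e where e: "e > 0" "\<And>v. v \<in> S \<Longrightarrow> e * b v \<le> a v" by auto
  define e' where "e' = (if b x > 0 then min e (a x / b x) else e)"
  have "e' > 0" using e(1) insert.prems[of x] by (simp add: e'_def)
  moreover have "e' * b v \<le> a v" if "v \<in> insert x S" for v
  proof (cases "v = x")
    case True
    show ?thesis
    proof (cases "b x > 0")
      case pos: True
      have "e' \<le> a x / b x" using pos by (simp add: e'_def)
      then show ?thesis using pos True by (simp add: pos_le_divide_eq)
    next
      case False
      have "e' * b x \<le> 0" using False e(1) by (simp add: e'_def mult_nonneg_nonpos)
      then show ?thesis using True insert.prems[of x] by simp
    qed
  next
    case False
    then have "v \<in> S" using that by simp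
    show ?thesis
    proof (cases "b v \<ge> 0")
      case True
      have "e' \<le> e" by (simp add: e'_def)
      then have "e' * b v \<le> e * b v" using True by (rule mult_right_mono)
      then show ?thesis using e(2)[OF \<open>v \<in> S\<close>] by simp
    next
      case neg: False
      have "e' * b v \<le> 0" using neg \<open>e' > 0\<close> by (simp add: mult_nonneg_nonpos)
      then show ?thesis using \<open>v \<in> S\<close> insert.prems[of v] by simp
    qed
  qed
  ultimately show ?case by blast
qed

text \<open>
  If \<open>\<mu>\<close> improves \<open>\<alpha>'\<close>, then a small positive multiple of the direction \<open>\<mu> - \<alpha>'\<close> improves
  \<open>\<alpha>\<close>: the direction is nonnegative outside the support of \<open>\<alpha>'\<close>, and \<open>\<alpha>\<close> is strictly
  positive on its own support. In particular all weights with the same support are minimal together,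
  which makes the supports of minimal weights the simplices of a triangulation.
\<close>

lemma lex_minimal_face:
  assumes min: "lex_minimal vs \<alpha>" and w: "\<alpha>' \<in> weights (set vs)" and sub: "supp \<alpha>' \<subseteq> supp \<alpha>"
  shows "lex_minimal vs \<alpha>'"
  unfolding lex_minimal_def
proof (intro conjI ballI impI notI)
  let ?V = "set vs"
  show "\<alpha>' \<in> weights ?V" by fact
  fix \<mu> assume \<mu>: "\<mu> \<in> weights ?V" "sum \<mu> ?V = sum \<alpha>' ?V" "combination ?V \<mu> = combination ?V \<alpha>'"
    and neg: "lex_negative vs (\<lambda>v. \<mu> v - \<alpha>' v)"
  have \<alpha>: "\<alpha> \<in> weights ?V" using min by (simp add: lex_minimal_def)
  have fin: "finite (supp \<alpha>)" using \<alpha> finite_subset[of "supp \<alpha>" ?V] by (auto simp: weights_supp)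
  have "0 < \<alpha> v" if "v \<in> supp \<alpha>" for v
    using that weights_nonneg[OF \<alpha>, of v] by (simp add: supp_def)
  then obtain e where e: "e > 0" "\<And>v. v \<in> supp \<alpha> \<Longrightarrow> e * \<alpha>' v \<le> \<alpha> v"
    using small_multiple_below[OF fin, of \<alpha> \<alpha>'] by blast
  define \<nu> where "\<nu> = (\<lambda>v. \<alpha> v + e * (\<mu> v - \<alpha>' v))"
  have "\<nu> \<in> weights ?V"
    unfolding weights_def
  proof (intro CollectI conjI allI impI)
    fix v
    have "0 \<le> e * \<mu> v" using e(1) weights_nonneg[OF \<mu>(1)] by simp
    moreover have "e * \<alpha>' v \<le> \<alpha> v"
    proof (cases "v \<in> supp \<alpha>")
      case False
      then have "v \<notin> supp \<alpha>'" using sub by auto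
      then show ?thesis using weights_nonneg[OF \<alpha>, of v] by (simp add: supp_def)
    qed (use e(2) in auto)
    ultimately show "0 \<le> \<nu> v" by (simp add: \<nu>_def algebra_simps)
    show "v \<notin> ?V \<Longrightarrow> \<nu> v = 0" using \<alpha> w \<mu>(1) by (simp add: \<nu>_def weights_def)
  qed
  moreover have "sum \<nu> ?V = sum \<alpha> ?V"
    using \<mu>(2) by (simp add: \<nu>_def sum.distrib sum_distrib_left[symmetric] sum_subtractf)
  moreover have "combination ?V \<nu> = combination ?V \<alpha>"
    using \<mu>(3) by (simp add: \<nu>_def combination_add combination_scale combination_diff)
  moreover have "lex_negative vs (\<lambda>v. \<nu> v - \<alpha> v)"
    using neg lex_negative_scale[OF e(1), of vs "\<lambda>v. \<mu> v - \<alpha>' v"] by (simp add: \<nu>_def)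
  ultimately show False using min by (simp add: lex_minimal_def)
qed

text \<open>
  One of the two signs of an affine dependence is lexicographically negative. Moving in this direction until
  the first weight vanishes decreases the weights and shrinks the support.
\<close>

lemma lex_decrease:
  assumes w: "\<alpha> \<in> weights (set vs)" and dep: "affine_dependent (supp \<alpha>)"
  shows "\<exists>\<mu>\<in>weights (set vs). sum \<mu> (set vs) = sum \<alpha> (set vs) \<and>
     combination (set vs) \<mu> = combination (set vs) \<alpha> \<and>
     lex_negative vs (\<lambda>v. \<mu> v - \<alpha> v) \<and> supp \<mu> \<subset> supp \<alpha>"
proof -
  let ?V = "set vs"
  have sub: "supp \<alpha> \<subseteq> ?V" using w by (simp add: weights_supp)
  then have fin: "finite (supp \<alpha>)" by (rule finite_subset) simp
  obtain U where U: "sum U (supp \<alpha>) = 0" "\<exists>v\<in>supp \<alpha>. U v \<noteq> 0" "(\<Sum>v\<in>supp \<alpha>. U v *\<^sub>R v) = 0"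
    using dep affine_dependent_explicit_finite[OF fin] by blast
  define d0 where "d0 = (\<lambda>v. if v \<in> supp \<alpha> then U v else 0)"
  have d0_supp: "supp d0 \<subseteq> supp \<alpha>" by (auto simp: d0_def supp_def)
  have d0: "sum d0 ?V = 0" "combination ?V d0 = 0"
    using U(1,3) combination_mono_neutral[OF _ sub d0_supp] by (simp_all add: combination_def d0_def)
  have "\<exists>v\<in>?V. d0 v \<noteq> 0" using U(2) sub by (auto simp: d0_def)
  then consider "lex_negative vs d0" | "lex_negative vs (\<lambda>v. - d0 v)"
    using lex_negative_total[of vs d0] by auto
  then obtain d where d: "lex_negative vs d" "sum d ?V = 0" "combination ?V d = 0" "supp d \<subseteq> supp \<alpha>"
  proof cases
    case 1
    then show thesis using that[of d0] d0 d0_supp by simp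
  next
    case 2
    have "combination ?V (\<lambda>v. - d0 v) = 0" using combination_scale[of ?V "-1" d0] d0(2) by simp
    then show thesis using that[OF 2] d0 d0_supp by (simp add: sum_negf supp_def)
  qed
  let ?N = "{v \<in> ?V. d v < 0}"
  have "?N \<noteq> {}"
  proof
    assume "?N = {}"
    then have "\<And>v. v \<in> ?V \<Longrightarrow> 0 \<le> d v" by (auto simp: not_less)
    then have "\<And>v. v \<in> ?V \<Longrightarrow> d v = 0" using d(2) sum_nonneg_eq_0_iff[of ?V d] by simp
    moreover have "v \<notin> ?V \<Longrightarrow> d v = 0" for v using d(4) sub by (auto simp: supp_def)
    ultimately show False using lex_negative_irrefl[of d vs] d(1) by blast
  qed
  \<comment> \<open>the largest step that keeps all weights nonnegative\<close>
  define e where "e = Min ((\<lambda>v. \<alpha> v / - d v) ` ?N)"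
  have "e \<in> (\<lambda>v. \<alpha> v / - d v) ` ?N" unfolding e_def using \<open>?N \<noteq> {}\<close> by (intro Min_in) auto
  then obtain v0 where v0: "v0 \<in> ?V" "d v0 < 0" "e = \<alpha> v0 / - d v0" by auto
  have e_le: "e \<le> \<alpha> v / - d v" if "v \<in> ?N" for v
    unfolding e_def using that by (intro Min_le) auto
  have "v0 \<in> supp \<alpha>" using v0(2) subsetD[OF d(4), of v0] by (simp add: in_supp)
  then have "0 < \<alpha> v0" using weights_nonneg[OF w, of v0] by (simp add: supp_def)
  then have "0 < e" using v0 by (simp add: divide_pos_neg)
  define \<mu> where "\<mu> = (\<lambda>v. \<alpha> v + e * d v)"
  have zero: "\<mu> v0 = 0" using v0 by (simp add: \<mu>_def)
  have "supp \<mu> \<subseteq> supp \<alpha>" using d(4) by (auto simp: \<mu>_def supp_def)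
  then have psub: "supp \<mu> \<subset> supp \<alpha>" using zero \<open>v0 \<in> supp \<alpha>\<close> by (auto simp: supp_def)
  have "0 \<le> \<mu> v" for v
  proof (cases "d v < 0")
    case True
    then have "v \<in> supp d" by (simp add: in_supp)
    then have "v \<in> ?N" using True d(4) sub by auto
    from e_le[OF this] have "e * - d v \<le> \<alpha> v"
      using True by (subst pos_le_divide_eq[symmetric]) auto
    then show ?thesis by (simp add: \<mu>_def)
  next
    case False
    then show ?thesis using weights_nonneg[OF w, of v] \<open>0 < e\<close> by (simp add: \<mu>_def)
  qed
  then have "\<mu> \<in> weights ?V" using psub sub by (auto simp: weights_supp)
  moreover have "sum \<mu> ?V = sum \<alpha> ?V"
    using d(2) by (simp add: \<mu>_def sum.distrib sum_distrib_left[symmetric])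
  moreover have "combination ?V \<mu> = combination ?V \<alpha>"
    using d(3) by (simp add: \<mu>_def combination_add combination_scale)
  moreover have "lex_negative vs (\<lambda>v. \<mu> v - \<alpha> v)"
    using d(1) lex_negative_scale[OF \<open>0 < e\<close>, of vs d] by (simp add: \<mu>_def)
  ultimately show ?thesis using psub by blast
qed

lemma lex_minimal_supp_affine_independent:
  "lex_minimal vs \<alpha> \<Longrightarrow> \<not> affine_dependent (supp \<alpha>)"
  using lex_decrease[of \<alpha> vs] by (auto simp: lex_minimal_def)

lemma affine_independent_weights_unique:
  assumes "finite S" "\<not> affine_dependent S" "supp \<alpha> \<subseteq> S" "supp \<mu> \<subseteq> S"
    "sum \<alpha> S = sum \<mu> S" "combination S \<alpha> = combination S \<mu>"
  shows "\<alpha> = \<mu>"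
proof -
  have "sum (\<lambda>v. \<alpha> v - \<mu> v) S = 0" "(\<Sum>v\<in>S. (\<alpha> v - \<mu> v) *\<^sub>R v) = 0"
    using assms(5,6) combination_diff[of S \<alpha> \<mu>] by (simp_all add: sum_subtractf combination_def)
  then have eq: "\<alpha> v - \<mu> v = 0" if "v \<in> S" for v
    using assms(2) that unfolding affine_dependent_explicit_finite[OF assms(1)] not_ex
    by (auto dest: spec[of _ "\<lambda>v. \<alpha> v - \<mu> v"])
  show ?thesis
  proof
    fix v
    show "\<alpha> v = \<mu> v"
      by (metis assms(3,4) eq in_supp right_minus_eq subsetD)
  qed
qed

text \<open>
  Compactness is avoided: by \<open>lex_decrease\<close> only weights with affinely independent support compete, and
  these are determined by their support, so there are finitely many.
\<close>

lemma lex_minimal_exists: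
  assumes "\<alpha> \<in> weights (set vs)"
  shows "\<exists>\<mu>. lex_minimal vs \<mu> \<and> sum \<mu> (set vs) = sum \<alpha> (set vs) \<and>
    combination (set vs) \<mu> = combination (set vs) \<alpha>"
proof -
  let ?V = "set vs"
  let ?W = "{\<mu> \<in> weights ?V. sum \<mu> ?V = sum \<alpha> ?V \<and> combination ?V \<mu> = combination ?V \<alpha>}"
  let ?C = "{\<mu> \<in> ?W. \<not> affine_dependent (supp \<mu>)}"
  \<comment> \<open>each competitor is dominated by one with affinely independent support\<close>
  have improve: "\<exists>\<mu>\<in>?C. \<mu> = \<nu> \<or> lex_negative vs (\<lambda>v. \<mu> v - \<nu> v)" if "\<nu> \<in> ?W" for \<nu>
    using that
  proof (induction "card (supp \<nu>)" arbitrary: \<nu> rule: less_induct)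
    case less
    show ?case
    proof (cases "affine_dependent (supp \<nu>)")
      case False
      then show ?thesis using less.prems by blast
    next
      case True
      then obtain \<mu> where \<mu>: "\<mu> \<in> ?W" "lex_negative vs (\<lambda>v. \<mu> v - \<nu> v)" "supp \<mu> \<subset> supp \<nu>"
        using lex_decrease[of \<nu> vs] less.prems by auto
      have "finite (supp \<nu>)"
        using less.prems finite_subset[of "supp \<nu>" ?V] by (auto simp: weights_supp)
      then have "card (supp \<mu>) < card (supp \<nu>)" using \<mu>(3) by (rule psubset_card_mono)
      from less.hyps[OF this \<mu>(1)] obtain \<mu>' where \<mu>': "\<mu>' \<in> ?C"
        "\<mu>' = \<mu> \<or> lex_negative vs (\<lambda>v. \<mu>' v - \<mu> v)" by blast
      then have "lex_negative vs (\<lambda>v. \<mu>' v - \<nu> v)"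
        using \<mu>(2) lex_negative_add[of vs "\<lambda>v. \<mu>' v - \<mu> v" "\<lambda>v. \<mu> v - \<nu> v"] by auto
      then show ?thesis using \<mu>'(1) by blast
    qed
  qed
  have "inj_on supp ?C"
  proof (rule inj_onI)
    fix \<mu> \<nu> assume C: "\<mu> \<in> ?C" "\<nu> \<in> ?C" "supp \<mu> = supp \<nu>"
    then have sub: "supp \<mu> \<subseteq> ?V" by (auto simp: weights_supp)
    show "\<mu> = \<nu>"
      using C sub combination_mono_neutral[OF _ sub, of \<mu>] combination_mono_neutral[OF _ sub, of \<nu>]
      by (intro affine_independent_weights_unique[of "supp \<mu>"]) (auto intro: finite_subset)
  qed
  moreover have "supp ` ?C \<subseteq> Pow ?V" by (auto simp: weights_supp)
  ultimately have fin: "finite ?C"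
    by (meson finite_Pow_iff finite_imageD finite_set finite_subset)
  have "?C \<noteq> {}" using improve[of \<alpha>] assms by auto
  moreover have "asymp_on ?C (\<lambda>\<mu> \<nu>. lex_negative vs (\<lambda>v. \<mu> v - \<nu> v))"
  proof (rule asymp_onI)
    fix \<mu> \<nu> assume "lex_negative vs (\<lambda>v. \<mu> v - \<nu> v)"
    then show "\<not> lex_negative vs (\<lambda>v. \<nu> v - \<mu> v)"
      using lex_negative_add[of vs "\<lambda>v. \<mu> v - \<nu> v" "\<lambda>v. \<nu> v - \<mu> v"]
        lex_negative_irrefl[of "\<lambda>v. \<mu> v - \<nu> v + (\<nu> v - \<mu> v)" vs] by auto
  qed
  moreover have "transp_on ?C (\<lambda>\<mu> \<nu>. lex_negative vs (\<lambda>v. \<mu> v - \<nu> v))"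
  proof (rule transp_onI)
    fix \<mu> \<nu> \<rho> assume "lex_negative vs (\<lambda>v. \<mu> v - \<nu> v)" "lex_negative vs (\<lambda>v. \<nu> v - \<rho> v)"
    then show "lex_negative vs (\<lambda>v. \<mu> v - \<rho> v)"
      using lex_negative_add[of vs "\<lambda>v. \<mu> v - \<nu> v" "\<lambda>v. \<nu> v - \<rho> v"] by simp
  qed
  ultimately obtain m where m: "m \<in> ?C"
    "\<And>\<mu>. \<mu> \<in> ?C \<Longrightarrow> \<mu> \<noteq> m \<Longrightarrow> \<not> lex_negative vs (\<lambda>v. \<mu> v - m v)"
    using Finite_Set.bex_min_element[OF fin, of "\<lambda>\<mu> \<nu>. lex_negative vs (\<lambda>v. \<mu> v - \<nu> v)"] by blast
  have "\<not> lex_negative vs (\<lambda>v. \<mu> v - m v)" if \<mu>: "\<mu> \<in> ?W" for \<mu>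
  proof
    assume neg: "lex_negative vs (\<lambda>v. \<mu> v - m v)"
    obtain \<mu>' where \<mu>': "\<mu>' \<in> ?C" "\<mu>' = \<mu> \<or> lex_negative vs (\<lambda>v. \<mu>' v - \<mu> v)"
      using improve[OF \<mu>] by blast
    then have "lex_negative vs (\<lambda>v. \<mu>' v - m v)"
      using neg lex_negative_add[of vs "\<lambda>v. \<mu>' v - \<mu> v" "\<lambda>v. \<mu> v - m v"] by auto
    moreover from this have "\<mu>' \<noteq> m"
      using lex_negative_irrefl[of "\<lambda>v. \<mu>' v - m v" vs] by auto
    ultimately show False using m(2) \<mu>'(1) by blast
  qed
  then have "lex_minimal vs m" using m(1) by (auto simp: lex_minimal_def)
  then show ?thesis using m(1) by blast
qed

section \<open>Lattice points in dilated simplices\<close>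

text \<open>
  The index set \<open>K\<close> allows the exclusion of \<open>k = 0\<close>, where the sum over the empty simplex is not
  polynomial.
\<close>

definition polynomial_on :: "nat set \<Rightarrow> nat \<Rightarrow> (nat \<Rightarrow> real) \<Rightarrow> bool" where
  "polynomial_on K d F \<longleftrightarrow> (\<exists>p. degree p \<le> d \<and> (\<forall>k\<in>K. F k = poly p (real k)))"

lemma polynomial_on_mono:
  "polynomial_on K d F \<Longrightarrow> K' \<subseteq> K \<Longrightarrow> d \<le> d' \<Longrightarrow> polynomial_on K' d' F"
  unfolding polynomial_on_def by (meson order_trans subsetD)

lemma polynomial_on_cong:
  "(\<And>k. k \<in> K \<Longrightarrow> F k = G k) \<Longrightarrow> polynomial_on K d F \<longleftrightarrow> polynomial_on K d G"
  by (auto simp: polynomial_on_def)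

lemma polynomial_on_zero: "polynomial_on K d (\<lambda>_. 0)"
  unfolding polynomial_on_def by (intro exI[of _ 0]) simp

lemma polynomial_on_add:
  assumes "polynomial_on K d F" "polynomial_on K d G"
  shows "polynomial_on K d (\<lambda>k. F k + G k)"
proof -
  obtain p q where "degree p \<le> d" "\<forall>k\<in>K. F k = poly p (real k)" "degree q \<le> d" "\<forall>k\<in>K. G k = poly q (real k)"
    using assms by (auto simp: polynomial_on_def)
  then show ?thesis unfolding polynomial_on_def by (intro exI[of _ "p + q"]) (auto intro: degree_add_le)
qed

lemma polynomial_on_cmult:
  assumes "polynomial_on K d F"
  shows "polynomial_on K d (\<lambda>k. c * F k)"
proof -
  obtain p where "degree p \<le> d" "\<forall>k\<in>K. F k = poly p (real k)"
    using assms by (auto simp: polynomial_on_def)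
  then show ?thesis unfolding polynomial_on_def
    by (intro exI[of _ "smult c p"]) (auto intro: order_trans[OF degree_smult_le])
qed

lemma polynomial_on_diff:
  assumes "polynomial_on K d F" "polynomial_on K d G"
  shows "polynomial_on K d (\<lambda>k. F k - G k)"
  using polynomial_on_add[OF assms(1) polynomial_on_cmult[OF assms(2), of "-1"]] by simp

lemma polynomial_on_sum:
  assumes "\<And>a. a \<in> A \<Longrightarrow> polynomial_on K d (F a)"
  shows "polynomial_on K d (\<lambda>k. \<Sum>a\<in>A. F a k)"
  using assms
  by (induction A rule: infinite_finite_induct) (auto intro: polynomial_on_zero polynomial_on_add)

lemma int_lattice_add: "x \<in> int_lattice \<Longrightarrow> y \<in> int_lattice \<Longrightarrow> x + y \<in> int_lattice"
  and int_lattice_diff: "x \<in> int_lattice \<Longrightarrow> y \<in> int_lattice \<Longrightarrow> x - y \<in> int_lattice"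
  and int_lattice_zero: "0 \<in> int_lattice"
  and int_lattice_scale: "c \<in> \<int> \<Longrightarrow> x \<in> int_lattice \<Longrightarrow> c *\<^sub>R x \<in> int_lattice"
  by (auto simp: int_lattice_def)

lemma int_lattice_combination:
  assumes "S \<subseteq> int_lattice" "\<And>v. v \<in> S \<Longrightarrow> \<alpha> v \<in> \<int>"
  shows "combination S \<alpha> \<in> int_lattice"
  unfolding combination_def using assms
proof (induction S rule: infinite_finite_induct)
  case (insert x S)
  then show ?case by (auto intro!: int_lattice_add int_lattice_scale)
qed (auto intro: int_lattice_zero)

lemma finite_bounded_int_lattice:
  fixes X :: "(real^'n::finite) set"
  assumes "bounded X"
  shows "finite (X \<inter> int_lattice)"
proof -
  obtain B where B: "\<And>x. x \<in> X \<Longrightarrow> norm x \<le> B" using assms by (auto simp: bounded_iff)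
  let ?F = "{f :: 'n \<Rightarrow> int. \<forall>i. (i \<in> UNIV \<longrightarrow> f i \<in> {-\<lceil>B\<rceil>..\<lceil>B\<rceil>}) \<and> (i \<notin> UNIV \<longrightarrow> f i = 0)}"
  have "X \<inter> int_lattice \<subseteq> (\<lambda>f. \<chi> i. real_of_int (f i)) ` ?F"
  proof
    fix x assume x: "x \<in> X \<inter> int_lattice"
    have eq: "real_of_int \<lfloor>x $ i\<rfloor> = x $ i" for i
      using x by (auto simp: int_lattice_def elim!: allE[of _ i] Ints_cases)
    have "\<lfloor>x $ i\<rfloor> \<in> {-\<lceil>B\<rceil>..\<lceil>B\<rceil>}" for i
    proof -
      have "\<bar>x $ i\<bar> \<le> B" using component_le_norm_cart[of x i] B[of x] x by auto
      then have "\<bar>real_of_int \<lfloor>x $ i\<rfloor>\<bar> \<le> real_of_int \<lceil>B\<rceil>" unfolding eq by linarith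
      then show ?thesis by auto
    qed
    moreover have "x = (\<chi> i. real_of_int \<lfloor>x $ i\<rfloor>)" by (simp add: vec_eq_iff eq)
    ultimately show "x \<in> (\<lambda>f. \<chi> i. real_of_int (f i)) ` ?F"
      by (intro image_eqI[of _ _ "\<lambda>i. \<lfloor>x $ i\<rfloor>"]) auto
  qed
  moreover have "finite ?F" by (intro finite_set_of_finite_funs) auto
  ultimately show ?thesis using finite_surj by blast
qed

lemma finite_lattice_weights:
  fixes S :: "(real^'n::finite) set"
  assumes "finite S" "\<not> affine_dependent S"
  shows "finite {\<alpha> \<in> weights S. sum \<alpha> S = c \<and> combination S \<alpha> \<in> int_lattice}" (is "finite ?A")
proof (rule finite_imageD)
  show "inj_on (combination S) ?A"
    by (rule inj_onI) (auto simp: weights_supp intro: affine_independent_weights_unique[OF assms])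
  have "combination S ` ?A \<subseteq> cball 0 (\<Sum>v\<in>S. c * norm v) \<inter> int_lattice"
  proof (rule image_subsetI)
    fix \<alpha> assume A: "\<alpha> \<in> ?A"
    then have \<alpha>: "\<alpha> \<in> weights S" "c = sum \<alpha> S" by auto
    have "norm (combination S \<alpha>) \<le> (\<Sum>v\<in>S. norm (\<alpha> v *\<^sub>R v))"
      unfolding combination_def by (rule norm_sum)
    also have "\<dots> \<le> (\<Sum>v\<in>S. c * norm v)"
    proof (rule sum_mono)
      fix v assume "v \<in> S"
      then have "\<alpha> v \<le> sum \<alpha> S"
        using assms(1) \<alpha>(1) by (intro member_le_sum) (auto simp: weights_def)
      then show "norm (\<alpha> v *\<^sub>R v) \<le> c * norm v"
        using \<alpha>(2) weights_nonneg[OF \<alpha>(1), of v] by (auto intro: mult_right_mono)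
    qed
    finally show "combination S \<alpha> \<in> cball 0 (\<Sum>v\<in>S. c * norm v) \<inter> int_lattice"
      using A by simp
  qed
  then show "finite (combination S ` ?A)"
    by (rule finite_subset) (intro finite_bounded_int_lattice bounded_cball)
qed

text \<open>
  For affinely independent \<open>S\<close> these parametrise the lattice points of the \<open>k\<close>-th dilate of the
  simplex spanned by \<open>S\<close>.
\<close>

definition lattice_weights :: "(real^'n::finite) set \<Rightarrow> nat \<Rightarrow> (real^'n \<Rightarrow> real) set" where
  "lattice_weights S k = {\<alpha> \<in> weights S. sum \<alpha> S = real k \<and> combination S \<alpha> \<in> int_lattice}"

text \<open>
  These parametrise the lattice points of the half-open fundamental parallelepiped of the cone over
  \<open>S\<close> placed at height 1; the sum of the weights is the height of the point.
\<close>

definition parallelepiped_weights :: "(real^'n::finite) set \<Rightarrow> (real^'n \<Rightarrow> real) set" where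
  "parallelepiped_weights S = {\<theta> \<in> weights S. (\<forall>v. \<theta> v < 1) \<and> sum \<theta> S \<in> \<int> \<and> combination S \<theta> \<in> int_lattice}"

definition height :: "'a set \<Rightarrow> ('a \<Rightarrow> real) \<Rightarrow> nat" where
  "height S \<theta> = nat \<lfloor>sum \<theta> S\<rfloor>"

lemma parallelepiped_height:
  assumes "\<theta> \<in> parallelepiped_weights S"
  shows "sum \<theta> S = real (height S \<theta>)" "finite S \<Longrightarrow> S \<noteq> {} \<Longrightarrow> height S \<theta> < card S"
proof -
  have "0 \<le> sum \<theta> S" using assms by (intro sum_nonneg) (auto simp: parallelepiped_weights_def weights_def)
  moreover have "sum \<theta> S \<in> \<int>" using assms by (simp add: parallelepiped_weights_def)
  ultimately show eq: "sum \<theta> S = real (height S \<theta>)" by (auto simp: height_def elim!: Ints_cases)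
  show "height S \<theta> < card S" if "finite S" "S \<noteq> {}"
  proof -
    have "sum \<theta> S < (\<Sum>v\<in>S. 1)"
      using that assms by (intro sum_strict_mono) (auto simp: parallelepiped_weights_def)
    then show ?thesis using eq by simp
  qed
qed

lemma finite_parallelepiped_weights:
  assumes "finite S" "S \<noteq> {}" "\<not> affine_dependent S"
  shows "finite (parallelepiped_weights S)"
proof (rule finite_subset)
  show "parallelepiped_weights S \<subseteq>
      (\<Union>h\<in>{..<card S}. {\<alpha> \<in> weights S. sum \<alpha> S = real h \<and> combination S \<alpha> \<in> int_lattice})"
    using parallelepiped_height assms(1,2) by (fastforce simp: parallelepiped_weights_def)
  show "finite \<dots>" using finite_lattice_weights assms by blast
qed

text \<open>
  Each weight splits into its fractional and its integer part. The integer parts contribute a lattice point, as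
  \<open>S\<close> consists of lattice points, so the fractional parts describe one as well.
\<close>

lemma sum_lattice_weights_eq:
  fixes f :: "(real^'n::finite \<Rightarrow> real) \<Rightarrow> real"
  assumes S: "finite S" "S \<noteq> {}" "\<not> affine_dependent S" "S \<subseteq> int_lattice"
  shows "(\<Sum>\<alpha>\<in>lattice_weights S k. f \<alpha>) =
    (\<Sum>\<theta>\<in>parallelepiped_weights S.
       \<Sum>m | m \<in> compositions S (k - height S \<theta>) \<and> height S \<theta> \<le> k. f (\<lambda>v. \<theta> v + real (m v)))"
proof -
  let ?M = "\<lambda>\<theta>. {m. m \<in> compositions S (k - height S \<theta>) \<and> height S \<theta> \<le> k}"
  have "(\<Sum>\<alpha>\<in>lattice_weights S k. f \<alpha>) =
     (\<Sum>(\<theta>,m)\<in>Sigma (parallelepiped_weights S) ?M. f (\<lambda>v. \<theta> v + real (m v)))"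
  proof (rule sum.reindex_bij_witness[where j = "\<lambda>\<alpha>. (\<lambda>v. frac (\<alpha> v), \<lambda>v. nat \<lfloor>\<alpha> v\<rfloor>)"
        and i = "\<lambda>(\<theta>,m). \<lambda>v. \<theta> v + real (m v)"])
    fix \<alpha> assume \<alpha>: "\<alpha> \<in> lattice_weights S k"
    then have w: "\<alpha> \<in> weights S" and sum: "sum \<alpha> S = real k" and lat: "combination S \<alpha> \<in> int_lattice"
      by (auto simp: lattice_weights_def)
    have split: "frac (\<alpha> v) + real (nat \<lfloor>\<alpha> v\<rfloor>) = \<alpha> v" for v
      using weights_nonneg[OF w, of v] by (simp add: frac_def)
    let ?\<theta> = "\<lambda>v. frac (\<alpha> v)" and ?m = "\<lambda>v. nat \<lfloor>\<alpha> v\<rfloor>"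
    show "(case (?\<theta>, ?m) of (\<theta>, m) \<Rightarrow> \<lambda>v. \<theta> v + real (m v)) = \<alpha>"
      by (simp add: split)
    show "(case (?\<theta>, ?m) of (\<theta>, m) \<Rightarrow> f (\<lambda>v. \<theta> v + real (m v))) = f \<alpha>"
      by (simp add: split)
    have tot: "sum ?\<theta> S + real (sum ?m S) = real k"
      using sum by (simp add: sum.distrib[symmetric] split)
    have "combination S ?\<theta> = combination S \<alpha> - combination S (\<lambda>v. real (?m v))"
      using combination_add[of S ?\<theta> "\<lambda>v. real (?m v)"] by (simp add: split)
    moreover have "combination S (\<lambda>v. real (?m v)) \<in> int_lattice"
      by (rule int_lattice_combination[OF S(4)]) simp
    ultimately have "combination S ?\<theta> \<in> int_lattice" using lat by (simp add: int_lattice_diff)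
    moreover have "sum ?\<theta> S \<in> \<int>"
    proof -
      have "sum ?\<theta> S = real k - real (sum ?m S)" using tot by simp
      then show ?thesis by (metis Ints_diff Ints_of_nat)
    qed
    moreover have "?\<theta> \<in> weights S" using w by (auto simp: weights_def)
    ultimately have \<theta>: "?\<theta> \<in> parallelepiped_weights S"
      by (simp add: parallelepiped_weights_def frac_lt_1)
    have "real (height S ?\<theta>) + real (sum ?m S) = real k" using tot parallelepiped_height(1)[OF \<theta>] by simp
    then have "height S ?\<theta> + sum ?m S = k" by (metis of_nat_add of_nat_eq_iff)
    then have "?m \<in> ?M ?\<theta>" using w by (auto simp: compositions_def weights_def)
    then show "(?\<theta>, ?m) \<in> Sigma (parallelepiped_weights S) ?M" using \<theta> by simp
  next
    fix \<theta>m assume "\<theta>m \<in> Sigma (parallelepiped_weights S) ?M"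
    moreover obtain \<theta> m where [simp]: "\<theta>m = (\<theta>, m)" by force
    ultimately have \<theta>: "\<theta> \<in> parallelepiped_weights S" and m: "m \<in> ?M \<theta>" by auto
    have fl: "0 \<le> \<theta> v" "\<theta> v < 1" for v using \<theta> by (auto simp: parallelepiped_weights_def weights_def)
    have "frac (\<theta> v + real (m v)) = \<theta> v" for v
    proof -
      have "frac (\<theta> v + of_int (int (m v))) = frac (\<theta> v)" by (rule frac_add_of_int_right)
      then show ?thesis using fl[of v] frac_eq[of "\<theta> v"] by simp
    qed
    moreover have "nat \<lfloor>\<theta> v + real (m v)\<rfloor> = m v" for v
    proof -
      have "\<lfloor>\<theta> v + real (m v)\<rfloor> = int (m v)" using fl[of v] by linarith
      then show ?thesis by simp
    qed
    ultimately show "(\<lambda>v. frac ((case \<theta>m of (\<theta>, m) \<Rightarrow> \<lambda>v. \<theta> v + real (m v)) v),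
        \<lambda>v. nat \<lfloor>(case \<theta>m of (\<theta>, m) \<Rightarrow> \<lambda>v. \<theta> v + real (m v)) v\<rfloor>) = \<theta>m" by simp
    have "combination S (\<lambda>v. real (m v)) \<in> int_lattice"
      by (rule int_lattice_combination[OF S(4)]) simp
    then have "combination S (\<lambda>v. \<theta> v + real (m v)) \<in> int_lattice"
      unfolding combination_add using \<theta> by (simp add: int_lattice_add parallelepiped_weights_def)
    moreover have "(\<Sum>v\<in>S. \<theta> v + real (m v)) = real k"
    proof -
      have "height S \<theta> + sum m S = k" using m by (auto simp: compositions_def)
      then show ?thesis using parallelepiped_height(1)[OF \<theta>] by (simp add: sum.distrib flip: of_nat_sum of_nat_add)
    qed
    moreover have "(\<lambda>v. \<theta> v + real (m v)) \<in> weights S"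
      using \<theta> m fl(1) by (auto simp: parallelepiped_weights_def weights_def compositions_def)
    ultimately show "(case \<theta>m of (\<theta>, m) \<Rightarrow> \<lambda>v. \<theta> v + real (m v)) \<in> lattice_weights S k"
      by (simp add: lattice_weights_def)
  qed
  also have "\<dots> = (\<Sum>\<theta>\<in>parallelepiped_weights S. \<Sum>m\<in>?M \<theta>. f (\<lambda>v. \<theta> v + real (m v)))"
    using finite_parallelepiped_weights[OF S(1-3)] finite_compositions[OF S(1)]
    by (intro sum.Sigma[symmetric]) auto
  finally show ?thesis .
qed

text \<open>
  The monomials of the tensor power in the weights: \<open>g\<close> chooses which summand \<open>v\<close> of the combination is
  paired with each of the \<open>r\<close> arguments.
\<close>

lemma tensor_power_combination:
  assumes "finite S"
  shows "tensor_power (combination S \<alpha>) r u =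
    (\<Sum>g\<in>PiE {..<r} (\<lambda>_. S). (\<Prod>i<r. g i \<bullet> u i) * (\<Prod>v\<in>S. \<alpha> v ^ card {i. i < r \<and> g i = v}))"
proof -
  have "tensor_power (combination S \<alpha>) r u = (\<Prod>i<r. \<Sum>v\<in>S. \<alpha> v * (v \<bullet> u i))"
    by (simp add: tensor_power_def combination_def inner_sum_left)
  also have "\<dots> = (\<Sum>g\<in>PiE {..<r} (\<lambda>_. S). \<Prod>i<r. \<alpha> (g i) * (g i \<bullet> u i))"
    using assms by (subst prod_sum_PiE) auto
  also have "\<dots> = (\<Sum>g\<in>PiE {..<r} (\<lambda>_. S). (\<Prod>i<r. g i \<bullet> u i) * (\<Prod>v\<in>S. \<alpha> v ^ card {i. i < r \<and> g i = v}))"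
  proof (rule sum.cong[OF refl])
    fix g assume g: "g \<in> PiE {..<r} (\<lambda>_. S)"
    have "(\<Prod>i<r. \<alpha> (g i)) = (\<Prod>v\<in>S. \<Prod>i\<in>{i \<in> {..<r}. g i = v}. \<alpha> (g i))"
      using g assms by (intro prod.group[symmetric]) auto
    also have "\<dots> = (\<Prod>v\<in>S. \<alpha> v ^ card {i. i < r \<and> g i = v})"
      by (intro prod.cong refl) simp
    finally show "(\<Prod>i<r. \<alpha> (g i) * (g i \<bullet> u i)) =
        (\<Prod>i<r. g i \<bullet> u i) * (\<Prod>v\<in>S. \<alpha> v ^ card {i. i < r \<and> g i = v})"
      by (simp add: prod.distrib)
  qed
  finally show ?thesis .
qed

lemma closed_simplex_polynomial:
  fixes S :: "(real^'n::finite) set"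
  assumes S: "finite S" "S \<noteq> {}" "\<not> affine_dependent S" "S \<subseteq> int_lattice"
  shows "polynomial_on UNIV (r + card S - 1) (\<lambda>k. \<Sum>\<alpha>\<in>lattice_weights S k. tensor_power (combination S \<alpha>) r u)"
proof -
  let ?c = "\<lambda>g v. card {i. i < r \<and> g i = v}"
  let ?M = "\<lambda>\<theta> k. {m. m \<in> compositions S (k - height S \<theta>) \<and> height S \<theta> \<le> k}"
  have "(\<Sum>\<alpha>\<in>lattice_weights S k. tensor_power (combination S \<alpha>) r u) =
    (\<Sum>\<theta>\<in>parallelepiped_weights S. \<Sum>g\<in>PiE {..<r} (\<lambda>_. S). (\<Prod>i<r. g i \<bullet> u i) *
       (\<Sum>m\<in>?M \<theta> k. \<Prod>v\<in>S. poly ([:\<theta> v, 1:] ^ ?c g v) (real (m v))))" for k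
    unfolding sum_lattice_weights_eq[OF S]
  proof (rule sum.cong[OF refl])
    fix \<theta>
    show "(\<Sum>m\<in>?M \<theta> k. tensor_power (combination S (\<lambda>v. \<theta> v + real (m v))) r u) =
      (\<Sum>g\<in>PiE {..<r} (\<lambda>_. S). (\<Prod>i<r. g i \<bullet> u i) *
       (\<Sum>m\<in>?M \<theta> k. \<Prod>v\<in>S. poly ([:\<theta> v, 1:] ^ ?c g v) (real (m v))))"
      unfolding tensor_power_combination[OF S(1)] sum_distrib_left by (subst sum.swap) simp
  qed
  moreover have "polynomial_on UNIV (r + card S - 1) (\<lambda>k. \<Sum>m\<in>?M \<theta> k. \<Prod>v\<in>S. poly ([:\<theta> v, 1:] ^ ?c g v) (real (m v)))"
    if \<theta>: "\<theta> \<in> parallelepiped_weights S" and g: "g \<in> PiE {..<r} (\<lambda>_. S)" for \<theta> g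
  proof -
    have "(\<Sum>v\<in>S. ?c g v) = (\<Sum>v\<in>S. \<Sum>i\<in>{i \<in> {..<r}. g i = v}. 1)" by simp
    also have "\<dots> = (\<Sum>i<r. 1)" using g S(1) by (intro sum.group) auto
    finally have "(\<Sum>v\<in>S. ?c g v) = r" by simp
    moreover have "degree ([:\<theta> v, 1:] ^ ?c g v) \<le> ?c g v" for v
      by (rule order_trans[OF degree_power_le]) simp
    ultimately show ?thesis
      using sum_compositions_polynomial[OF S(1) parallelepiped_height(2)[OF \<theta> S(1,2)], of "\<lambda>v. [:\<theta> v, 1:] ^ ?c g v" "?c g"]
      unfolding polynomial_on_def by simp
  qed
  ultimately show ?thesis by (simp only:) (intro polynomial_on_sum polynomial_on_cmult)
qed

definition open_lattice_weights :: "(real^'n::finite) set \<Rightarrow> nat \<Rightarrow> (real^'n \<Rightarrow> real) set" where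
  "open_lattice_weights S k = {\<alpha> \<in> lattice_weights S k. supp \<alpha> = S}"

lemma lattice_weights_face:
  assumes "finite S" "T \<subseteq> S"
  shows "{\<alpha> \<in> lattice_weights S k. supp \<alpha> = T} = open_lattice_weights T k"
  using assms combination_mono_neutral[OF assms]
  by (auto simp: lattice_weights_def open_lattice_weights_def weights_supp)

text \<open>
  Sorting weights by support writes the closed simplex as the disjoint union of its open faces; induction over
  proper subsets solves for the open simplex.
\<close>

lemma open_simplex_polynomial:
  fixes S :: "(real^'n::finite) set"
  assumes "finite S" "\<not> affine_dependent S" "S \<subseteq> int_lattice" "card S \<le> Suc d"
  shows "polynomial_on {k. 1 \<le> k \<or> 1 \<le> r} (d + r)
    (\<lambda>k. \<Sum>\<alpha>\<in>open_lattice_weights S k. tensor_power (combination S \<alpha>) r u)"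
  using assms
proof (induction S rule: finite_psubset_induct)
  case (psubset S)
  let ?K = "{k. 1 \<le> k \<or> 1 \<le> r}"
  let ?G = "\<lambda>T k. \<Sum>\<alpha>\<in>open_lattice_weights T k. tensor_power (combination T \<alpha>) r u"
  show ?case
  proof (cases "S = {}")
    case True
    \<comment> \<open>the empty simplex contributes at \<open>k = 0\<close> only, and nothing there if \<open>r \<ge> 1\<close>\<close>
    have "?G {} k = 0" if "k \<in> ?K" for k
    proof (cases "r = 0")
      case True
      then have "open_lattice_weights S k = {}"
        using that \<open>S = {}\<close> by (auto simp: open_lattice_weights_def lattice_weights_def)
      then show ?thesis by (simp add: \<open>S = {}\<close>)
    next
      case False
      then show ?thesis by (simp add: tensor_power_def combination_def)
    qed
    then show ?thesis
      using True polynomial_on_cong[of ?K "?G {}" "\<lambda>_. 0"] polynomial_on_zero by auto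
  next
    case False
    have "?G S k = (\<Sum>\<alpha>\<in>lattice_weights S k. tensor_power (combination S \<alpha>) r u) - (\<Sum>T\<in>Pow S - {S}. ?G T k)" for k
    proof -
      have "finite (lattice_weights S k)"
        unfolding lattice_weights_def using psubset by (intro finite_lattice_weights)
      then have "(\<Sum>\<alpha>\<in>lattice_weights S k. tensor_power (combination S \<alpha>) r u) =
         (\<Sum>T\<in>Pow S. \<Sum>\<alpha>\<in>{\<alpha> \<in> lattice_weights S k. supp \<alpha> = T}. tensor_power (combination S \<alpha>) r u)"
        using psubset by (intro sum.group[symmetric]) (auto simp: lattice_weights_def weights_supp)
      also have "\<dots> = (\<Sum>T\<in>Pow S. ?G T k)"
      proof (rule sum.cong[OF refl])
        fix T assume "T \<in> Pow S"
        then show "(\<Sum>\<alpha>\<in>{\<alpha> \<in> lattice_weights S k. supp \<alpha> = T}. tensor_power (combination S \<alpha>) r u) = ?G T k"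
          using lattice_weights_face[OF psubset.hyps(1), of T k] combination_mono_neutral(1)[OF psubset.hyps(1), of T]
          by (intro sum.cong) (auto simp: open_lattice_weights_def)
      qed
      also have "\<dots> = ?G S k + (\<Sum>T\<in>Pow S - {S}. ?G T k)"
        using psubset by (intro sum.remove) auto
      finally show ?thesis by simp
    qed
    moreover have "polynomial_on ?K (d + r) (\<lambda>k. \<Sum>\<alpha>\<in>lattice_weights S k. tensor_power (combination S \<alpha>) r u)"
      using psubset False
      by (intro polynomial_on_mono[OF closed_simplex_polynomial]) auto
    moreover have "polynomial_on ?K (d + r) (\<lambda>k. \<Sum>T\<in>Pow S - {S}. ?G T k)"
    proof (rule polynomial_on_sum)
      fix T assume T: "T \<in> Pow S - {S}"
      then have "T \<subset> S" by auto
      moreover from this have "card T \<le> card S" using psubset.hyps by (intro card_mono) auto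
      ultimately show "polynomial_on ?K (d + r) (?G T)"
        using psubset affine_dependent_subset by (intro psubset.IH) auto
    qed
    ultimately show ?thesis by (simp only:) (intro polynomial_on_diff)
  qed
qed

section \<open>Lattice points in dilated polytopes\<close>

text \<open>
  For \<open>k = 0\<close> the empty set has to be excluded: its zero weights represent \<open>0\<close>, but the
  dilate of its convex hull is empty.
\<close>

lemma dilate_convex_hull:
  assumes "finite V" "V \<noteq> {}"
  shows "dilate k (convex hull V) = combination V ` {\<alpha> \<in> weights V. sum \<alpha> V = real k}"
proof (intro subset_antisym subsetI)
  fix y assume "y \<in> dilate k (convex hull V)"
  then obtain x where x: "x \<in> convex hull V" "y = real k *\<^sub>R x" by (auto simp: dilate_def)
  then obtain w where w: "\<forall>v\<in>V. 0 \<le> w v" "sum w V = 1" "(\<Sum>v\<in>V. w v *\<^sub>R v) = x"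
    using assms(1) by (auto simp: convex_hull_finite)
  let ?\<alpha> = "\<lambda>v. if v \<in> V then real k * w v else 0"
  have "combination V ?\<alpha> = y" using x(2) w(3) by (simp add: combination_def scaleR_sum_right[symmetric] flip: scaleR_scaleR)
  moreover have "sum ?\<alpha> V = real k" using w(2) by (simp add: sum_distrib_left[symmetric])
  moreover have "?\<alpha> \<in> weights V" using w(1) by (auto simp: weights_def)
  ultimately show "y \<in> combination V ` {\<alpha> \<in> weights V. sum \<alpha> V = real k}" by blast
next
  fix y assume "y \<in> combination V ` {\<alpha> \<in> weights V. sum \<alpha> V = real k}"
  then obtain \<alpha> where \<alpha>: "\<alpha> \<in> weights V" "sum \<alpha> V = real k" "y = combination V \<alpha>" by auto
  show "y \<in> dilate k (convex hull V)"
  proof (cases "k = 0")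
    case True
    then have "\<forall>v\<in>V. \<alpha> v = 0"
      using \<alpha> assms(1) sum_nonneg_eq_0_iff[of V \<alpha>] by (auto simp: weights_def)
    then have "y = 0" using \<alpha>(3) by (simp add: combination_def)
    moreover obtain x where "x \<in> convex hull V" using assms(2) hull_inc[of _ V convex] by blast
    ultimately show ?thesis using True by (auto simp: dilate_def intro!: image_eqI[of _ _ x])
  next
    case False
    let ?w = "\<lambda>v. \<alpha> v / real k"
    have "(\<Sum>v\<in>V. ?w v *\<^sub>R v) \<in> convex hull V"
      using \<alpha>(1,2) False assms(1)
      by (auto simp: convex_hull_finite weights_def sum_divide_distrib[symmetric] intro!: exI[of _ ?w])
    moreover have "y = real k *\<^sub>R (\<Sum>v\<in>V. ?w v *\<^sub>R v)"
      using False \<alpha>(3) by (simp add: combination_def scaleR_sum_right)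
    ultimately show ?thesis by (auto simp: dilate_def)
  qed
qed

text \<open>
  Ehrhart's theorem with the tensor power as weight. The supports \<open>\<Sigma>\<close> of minimal weights triangulate
  \<open>P\<close>, and the same family triangulates every dilate.
\<close>

theorem lattice_polytope_moment_polynomial:
  fixes P :: "(real^'n::finite) set"
  assumes "P \<in> lattice_polytopes"
  shows "polynomial_on {k. 1 \<le> k \<or> 1 \<le> r} (CARD('n) + r) (\<lambda>k. discrete_moment r (dilate k P) u)"
proof (cases "P = {}")
  case True
  then show ?thesis by (simp add: dilate_def discrete_moment_def polynomial_on_zero)
next
  case False
  define V where "V = {x. x extreme_point_of P}"
  have poly: "polytope P" and lat: "V \<subseteq> int_lattice"
    using assms by (auto simp: lattice_polytopes_def V_def)
  have fin: "finite V" unfolding V_def using poly finite_polyhedron_extreme_points polytope_imp_polyhedron by blast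
  have hull: "P = convex hull V"
    unfolding V_def using poly by (intro Krein_Milman_Minkowski) (auto simp: polytope_imp_compact polytope_imp_convex)
  have "V \<noteq> {}" using False hull by auto
  obtain vs where vs: "set vs = V" using finite_list[OF fin] by blast
  define \<Sigma> where "\<Sigma> = supp ` {\<alpha>. lex_minimal vs \<alpha>}"
  define A where "A = (\<lambda>k. {\<alpha>. lex_minimal vs \<alpha> \<and> \<alpha> \<in> lattice_weights V k})"
  have \<Sigma>: "T \<subseteq> V" "\<not> affine_dependent T" if "T \<in> \<Sigma>" for T
    using that lex_minimal_supp_affine_independent[of vs]
    by (auto simp: \<Sigma>_def lex_minimal_def vs weights_supp)
  have "finite \<Sigma>" using \<Sigma>(1) fin by (meson PowI finite_Pow_iff finite_subset subsetI)
  have bij: "bij_betw (combination V) (A k) (dilate k P \<inter> int_lattice)" for k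
    unfolding bij_betw_def
  proof
    show "inj_on (combination V) (A k)"
      using lex_minimal_unique[of vs] by (intro inj_onI) (auto simp: A_def lattice_weights_def vs)
    show "combination V ` A k = dilate k P \<inter> int_lattice"
    proof (intro subset_antisym subsetI)
      fix x assume "x \<in> dilate k P \<inter> int_lattice"
      then obtain \<alpha> where \<alpha>: "\<alpha> \<in> weights V" "sum \<alpha> V = real k" "x = combination V \<alpha>" "x \<in> int_lattice"
        unfolding hull dilate_convex_hull[OF fin \<open>V \<noteq> {}\<close>] by auto
      obtain \<mu> where "lex_minimal vs \<mu>" "sum \<mu> V = real k" "combination V \<mu> = x"
        using lex_minimal_exists[of \<alpha> vs] \<alpha> vs by auto
      then show "x \<in> combination V ` A k"
        using \<alpha>(4) vs by (auto simp: A_def lattice_weights_def lex_minimal_def)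
    next
      fix x assume "x \<in> combination V ` A k"
      then show "x \<in> dilate k P \<inter> int_lattice"
        unfolding hull dilate_convex_hull[OF fin \<open>V \<noteq> {}\<close>] by (auto simp: A_def lattice_weights_def)
    qed
  qed
  have finA: "finite (A k)" for k
  proof -
    have "bounded (dilate k P)"
      unfolding dilate_def using poly by (intro bounded_scaling polytope_imp_bounded)
    then show ?thesis using finite_bounded_int_lattice bij_betw_finite[OF bij] by blast
  qed
  have "discrete_moment r (dilate k P) u =
     1 / fact r * (\<Sum>T\<in>\<Sigma>. \<Sum>\<alpha>\<in>open_lattice_weights T k. tensor_power (combination T \<alpha>) r u)" for k
  proof -
    have "discrete_moment r (dilate k P) u = (\<Sum>\<alpha>\<in>A k. tensor_power (combination V \<alpha>) r u) / fact r"
      unfolding discrete_moment_def using sum.reindex_bij_betw[OF bij, of "\<lambda>x. tensor_power x r u"] by simp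
    also have "(\<Sum>\<alpha>\<in>A k. tensor_power (combination V \<alpha>) r u) =
        (\<Sum>T\<in>\<Sigma>. \<Sum>\<alpha>\<in>{\<alpha> \<in> A k. supp \<alpha> = T}. tensor_power (combination V \<alpha>) r u)"
      using finA \<open>finite \<Sigma>\<close> by (intro sum.group[symmetric]) (auto simp: A_def \<Sigma>_def)
    also have "\<dots> = (\<Sum>T\<in>\<Sigma>. \<Sum>\<alpha>\<in>open_lattice_weights T k. tensor_power (combination T \<alpha>) r u)"
    proof (rule sum.cong[OF refl])
      fix T assume T: "T \<in> \<Sigma>"
      \<comment> \<open>minimality is a property of the support\<close>
      have "{\<alpha> \<in> A k. supp \<alpha> = T} = {\<alpha> \<in> lattice_weights V k. supp \<alpha> = T}"
        using T lex_minimal_face[of vs] by (auto simp: A_def \<Sigma>_def lattice_weights_def vs)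
      also have "\<dots> = open_lattice_weights T k" by (rule lattice_weights_face[OF fin \<Sigma>(1)[OF T]])
      finally show "(\<Sum>\<alpha>\<in>{\<alpha> \<in> A k. supp \<alpha> = T}. tensor_power (combination V \<alpha>) r u) =
          (\<Sum>\<alpha>\<in>open_lattice_weights T k. tensor_power (combination T \<alpha>) r u)"
        using combination_mono_neutral(1)[OF fin \<Sigma>(1)[OF T]]
        by (intro sum.cong) (auto simp: open_lattice_weights_def)
    qed
    finally show ?thesis by simp
  qed
  moreover have "polynomial_on {k. 1 \<le> k \<or> 1 \<le> r} (CARD('n) + r)
      (\<lambda>k. \<Sum>\<alpha>\<in>open_lattice_weights T k. tensor_power (combination T \<alpha>) r u)" if T: "T \<in> \<Sigma>" for T
  proof (rule open_simplex_polynomial)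
    show "finite T" using \<Sigma>(1)[OF T] fin by (rule finite_subset)
    show "\<not> affine_dependent T" by (rule \<Sigma>(2)[OF T])
    then have "int (card T) - 1 \<le> int (DIM(real^'n))"
      using aff_dim_affine_independent[of T] aff_dim_le_DIM[of T] by simp
    then show "card T \<le> Suc CARD('n)" by simp
    show "T \<subseteq> int_lattice" using \<Sigma>(1)[OF T] lat by simp
  qed
  ultimately show ?thesis by (simp only:) (intro polynomial_on_sum polynomial_on_cmult)
qed

section \<open>The binomial theorem for symmetric tensor powers\<close>

lemma ex_permutes_image_lessThan:
  assumes "X \<subseteq> {..<r}"
  shows "\<exists>\<tau>. \<tau> permutes {..<r} \<and> \<tau> ` {..<card X} = X \<and> \<tau> ` {card X..<r} = {..<r} - X"
proof -
  let ?p = "card X"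
  have fin: "finite X" using assms finite_subset by blast
  have le: "?p \<le> r" using card_mono[OF _ assms] by simp
  obtain f where f: "bij_betw f {..<?p} X"
    using fin finite_same_card_bij[of "{..<?p}" X] by auto
  have "card {?p..<r} = card ({..<r} - X)"
    using assms fin by (simp add: card_Diff_subset)
  then obtain g where g: "bij_betw g {?p..<r} ({..<r} - X)"
    using finite_same_card_bij[of "{?p..<r}" "{..<r} - X"] by auto
  define \<tau> where "\<tau> = (\<lambda>i. if i < ?p then f i else if i < r then g i else i)"
  have f': "bij_betw \<tau> {..<?p} X" using f by (rule bij_betw_cong[THEN iffD1, rotated]) (simp add: \<tau>_def)
  have g': "bij_betw \<tau> {?p..<r} ({..<r} - X)"
    using g by (rule bij_betw_cong[THEN iffD1, rotated]) (simp add: \<tau>_def)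
  have "bij_betw \<tau> ({..<?p} \<union> {?p..<r}) (X \<union> ({..<r} - X))"
    using f' g' by (rule bij_betw_combine) auto
  moreover have "{..<?p} \<union> {?p..<r} = {..<r}" using le by auto
  moreover have "X \<union> ({..<r} - X) = {..<r}" using assms by auto
  ultimately have "\<tau> permutes {..<r}" using le by (intro bij_imp_permutes) (auto simp: \<tau>_def)
  then show ?thesis using f' g' by (auto simp: bij_betw_def)
qed

lemma sym_product_tensor_power:
  assumes "p + q = r"
  shows "fact r * sym_product p q (tensor_power x p) (tensor_power y q) v =
    (\<Sum>\<sigma> | \<sigma> permutes {..<r}. (\<Prod>i\<in>{..<p}. x \<bullet> v (\<sigma> i)) * (\<Prod>i\<in>{p..<r}. y \<bullet> v (\<sigma> i)))"
proof -
  have "(\<Prod>i\<in>{p..<r}. y \<bullet> v (\<sigma> i)) = (\<Prod>i<q. y \<bullet> v (\<sigma> (p + i)))" for \<sigma>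
    using prod.atLeastLessThan_shift_0[of "\<lambda>i. y \<bullet> v (\<sigma> i)" p r] assms
    by (auto simp: atLeast0LessThan add.commute)
  then show ?thesis using assms by (simp add: sym_product_def tensor_power_def)
qed

text \<open>
  Averaging over all permutations of the arguments does not change the left-hand side. In the expansion into
  subsets \<open>X\<close> of argument positions, the average turns the term of \<open>X\<close> into that of an initial
  segment of the same size, which is a symmetric product; there are \<open>r choose p\<close> subsets of size
  \<open>p\<close>.
\<close>

lemma tensor_power_add:
  "tensor_power (x + y) r v =
    (\<Sum>p\<le>r. real (r choose p) * sym_product p (r - p) (tensor_power x p) (tensor_power y (r - p)) v)"
proof -
  let ?S = "{\<sigma>. \<sigma> permutes {..<r}}"
  let ?t = "\<lambda>\<sigma> X. (\<Prod>i\<in>X. x \<bullet> v (\<sigma> i)) * (\<Prod>i\<in>{..<r} - X. y \<bullet> v (\<sigma> i))"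
  let ?s = "\<lambda>p. sym_product p (r - p) (tensor_power x p) (tensor_power y (r - p)) v"
  have S: "card ?S = fact r" "finite ?S" using card_permutations[of "{..<r}" r] by (auto intro: finite_permutations)
  have subset: "(\<Sum>\<sigma>\<in>?S. ?t \<sigma> X) = fact r * ?s (card X)" if X: "X \<subseteq> {..<r}" for X
  proof -
    obtain \<tau> where \<tau>: "\<tau> permutes {..<r}" "\<tau> ` {..<card X} = X" "\<tau> ` {card X..<r} = {..<r} - X"
      using ex_permutes_image_lessThan[OF X] by blast
    have inj: "inj_on \<tau> A" for A using permutes_inj[OF \<tau>(1)] inj_on_subset by blast
    \<comment> \<open>\<open>\<tau>\<close> moves the initial segment to \<open>X\<close> and is absorbed by the sum over \<open>\<sigma>\<close>\<close>
    have "?t \<sigma> X = (\<Prod>i\<in>{..<card X}. x \<bullet> v ((\<sigma> \<circ> \<tau>) i)) * (\<Prod>i\<in>{card X..<r}. y \<bullet> v ((\<sigma> \<circ> \<tau>) i))" for \<sigma>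
      unfolding \<tau>(3)[symmetric] by (subst \<tau>(2)[symmetric]) (simp add: prod.reindex inj)
    then have "(\<Sum>\<sigma>\<in>?S. ?t \<sigma> X) =
        (\<Sum>\<sigma>\<in>?S. (\<Prod>i\<in>{..<card X}. x \<bullet> v (\<sigma> i)) * (\<Prod>i\<in>{card X..<r}. y \<bullet> v (\<sigma> i)))"
      by (simp only:) (rule sum_permutations_compose_right[OF \<tau>(1), symmetric])
    also have "\<dots> = fact r * ?s (card X)"
      using card_mono[OF _ X] by (intro sym_product_tensor_power[symmetric]) simp
    finally show ?thesis .
  qed
  have "fact r * tensor_power (x + y) r v = (\<Sum>\<sigma>\<in>?S. tensor_power (x + y) r v)"
    using S(1) by simp
  also have "\<dots> = (\<Sum>\<sigma>\<in>?S. \<Prod>i<r. x \<bullet> v (\<sigma> i) + y \<bullet> v (\<sigma> i))"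
  proof (rule sum.cong[OF refl])
    fix \<sigma> assume "\<sigma> \<in> ?S"
    then have "tensor_power (x + y) r v = (\<Prod>i<r. (x + y) \<bullet> v (\<sigma> i))"
      unfolding tensor_power_def by (subst prod.permute[of \<sigma>]) simp_all
    then show "tensor_power (x + y) r v = (\<Prod>i<r. x \<bullet> v (\<sigma> i) + y \<bullet> v (\<sigma> i))"
      by (simp add: inner_add_left)
  qed
  also have "\<dots> = (\<Sum>\<sigma>\<in>?S. \<Sum>X\<in>Pow {..<r}. ?t \<sigma> X)"
    by (simp add: prod_add)
  also have "\<dots> = (\<Sum>X\<in>Pow {..<r}. \<Sum>\<sigma>\<in>?S. ?t \<sigma> X)" by (rule sum.swap)
  also have "\<dots> = (\<Sum>X\<in>Pow {..<r}. fact r * ?s (card X))"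
    using subset by (intro sum.cong) auto
  also have "\<dots> = (\<Sum>p\<in>{..r}. \<Sum>X\<in>{X \<in> Pow {..<r}. card X = p}. fact r * ?s (card X))"
    using card_mono[of "{..<r}"] by (intro sum.group[symmetric]) force+
  also have "\<dots> = (\<Sum>p\<in>{..r}. fact r * (real (r choose p) * ?s p))"
  proof (rule sum.cong[OF refl])
    fix p
    have "(\<Sum>X\<in>{X \<in> Pow {..<r}. card X = p}. fact r * ?s (card X)) = real (card {X. X \<subseteq> {..<r} \<and> card X = p}) * (fact r * ?s p)"
      by simp
    then show "(\<Sum>X\<in>{X \<in> Pow {..<r}. card X = p}. fact r * ?s (card X)) = fact r * (real (r choose p) * ?s p)"
      by (simp add: n_subsets)
  qed
  finally show ?thesis by (simp add: sum_distrib_left[symmetric])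
qed

lemma discrete_moment_translate:
  assumes "y \<in> int_lattice"
  shows "discrete_moment r ((\<lambda>x. x + y) ` X) v =
    (\<Sum>j\<le>r. sym_product (r - j) j (discrete_moment (r - j) X) (tensor_power y j) v / fact j)"
proof -
  have "(\<lambda>x. x + y) ` X \<inter> int_lattice = (\<lambda>x. x + y) ` (X \<inter> int_lattice)"
    using assms int_lattice_add[OF _ assms] int_lattice_diff[OF _ assms] by fastforce
  then have "discrete_moment r ((\<lambda>x. x + y) ` X) v = (\<Sum>x\<in>X \<inter> int_lattice. tensor_power (x + y) r v / fact r)"
    by (simp add: discrete_moment_def sum.reindex sum_divide_distrib)
  also have "\<dots> = (\<Sum>x\<in>X \<inter> int_lattice. \<Sum>j\<le>r.
      sym_product (r - j) j (tensor_power x (r - j)) (tensor_power y j) v / (fact (r - j) * fact j))"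
  proof (rule sum.cong[OF refl])
    fix x
    have "tensor_power (x + y) r v / fact r = (\<Sum>j\<le>r. real (r choose (r - j)) / fact r *
        sym_product (r - j) (r - (r - j)) (tensor_power x (r - j)) (tensor_power y (r - (r - j))) v)"
      unfolding tensor_power_add sum_divide_distrib
      by (rule sum.reindex_bij_witness[of _ "\<lambda>j. r - j" "\<lambda>j. r - j"]) auto
    also have "\<dots> = (\<Sum>j\<le>r. sym_product (r - j) j (tensor_power x (r - j)) (tensor_power y j) v / (fact (r - j) * fact j))"
      by (intro sum.cong refl) (simp add: binomial_fact)
    finally show "tensor_power (x + y) r v / fact r = \<dots>" .
  qed
  also have "\<dots> = (\<Sum>j\<le>r. \<Sum>x\<in>X \<inter> int_lattice.
      sym_product (r - j) j (tensor_power x (r - j)) (tensor_power y j) v / (fact (r - j) * fact j))"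
    by (rule sum.swap)
  also have "\<dots> = (\<Sum>j\<le>r. sym_product (r - j) j (discrete_moment (r - j) X) (tensor_power y j) v / fact j)"
  proof (rule sum.cong[OF refl])
    fix j
    let ?S = "{\<sigma>. \<sigma> permutes {..<(r - j) + j}}"
    have "sym_product (r - j) j (discrete_moment (r - j) X) (tensor_power y j) v =
      (\<Sum>\<sigma>\<in>?S. \<Sum>x\<in>X \<inter> int_lattice. tensor_power x (r - j) (\<lambda>i. v (\<sigma> i)) *
         tensor_power y j (\<lambda>i. v (\<sigma> (r - j + i))) / (fact (r - j) * fact (r - j + j)))"
      by (simp add: sym_product_def discrete_moment_def sum_divide_distrib sum_distrib_right)
    also have "\<dots> = (\<Sum>x\<in>X \<inter> int_lattice. sym_product (r - j) j (tensor_power x (r - j)) (tensor_power y j) v / fact (r - j))"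
      by (subst sum.swap) (simp add: sym_product_def sum_divide_distrib mult.commute)
    finally show "(\<Sum>x\<in>X \<inter> int_lattice.
      sym_product (r - j) j (tensor_power x (r - j)) (tensor_power y j) v / (fact (r - j) * fact j)) =
      sym_product (r - j) j (discrete_moment (r - j) X) (tensor_power y j) v / fact j"
      by (simp add: sum_divide_distrib)
  qed
  finally show ?thesis .
qed

section \<open>The Ehrhart tensor polynomial and its coefficients\<close>

lemma dilate_dilate: "dilate k (dilate m P) = dilate (k * m) P"
  by (simp add: dilate_def image_image)

lemma discrete_moment_sym_tensor: "discrete_moment r X \<in> sym_tensors r"
  unfolding sym_tensors_def
proof (intro CollectI conjI allI impI)
  fix v w :: "nat \<Rightarrow> real^'a"
  assume "\<forall>i<r. v i = w i"
  then show "discrete_moment r X v = discrete_moment r X w"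
    by (simp add: discrete_moment_def tensor_power_def)
next
  fix v :: "nat \<Rightarrow> real^'a" and i assume i: "i < r"
  have "tensor_power x r (v(i := y)) = (x \<bullet> y) * (\<Prod>j\<in>{..<r} - {i}. x \<bullet> v j)" for x y
    unfolding tensor_power_def using i by (subst prod.remove[of _ i]) auto
  then show "linear (\<lambda>y. discrete_moment r X (v(i := y)))"
    unfolding discrete_moment_def
    by (intro linearI)
      (simp_all add: inner_add_right distrib_right sum.distrib add_divide_distrib sum_distrib_left mult.assoc)
next
  fix v :: "nat \<Rightarrow> real^'a" and \<sigma> :: "nat \<Rightarrow> nat" assume "\<sigma> permutes {..<r}"
  then have "tensor_power x r v = tensor_power x r (v \<circ> \<sigma>)" for x
    unfolding tensor_power_def by (subst prod.permute[of \<sigma>]) simp_all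
  then show "discrete_moment r X (v \<circ> \<sigma>) = discrete_moment r X v"
    by (simp add: discrete_moment_def)
qed

text \<open>
  Only positive \<open>k\<close> are prescribed, since \<open>lattice_polytope_moment_polynomial\<close> leaves out \<open>k = 0\<close> when
  \<open>r = 0\<close>; they determine the polynomial.
\<close>

definition ehrhart_polynomial :: "nat \<Rightarrow> (real^'n::finite) set \<Rightarrow> (nat \<Rightarrow> real^'n) \<Rightarrow> real poly" where
  "ehrhart_polynomial r P v = (SOME p. \<forall>k\<ge>1. discrete_moment r (dilate k P) v = poly p (real k))"

lemma poly_eqI_positive_nats:
  fixes p q :: "real poly"
  assumes "\<And>k. 1 \<le> k \<Longrightarrow> poly p (real k) = poly q (real k)"
  shows "p = q"
proof (rule ccontr)
  assume "p \<noteq> q"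
  then have "finite {x. poly (p - q) x = 0}" by (intro poly_roots_finite) simp
  moreover have "real ` {1..} \<subseteq> {x. poly (p - q) x = 0}" using assms by auto
  ultimately have "finite (real ` {1..})" by (rule rev_finite_subset)
  then show False by (simp add: finite_image_iff inj_on_def infinite_Ici)
qed

lemma ehrhart_polynomial_eqI:
  assumes "\<And>k. 1 \<le> k \<Longrightarrow> discrete_moment r (dilate k P) v = poly p (real k)"
  shows "ehrhart_polynomial r P v = p"
proof -
  have "\<forall>k\<ge>1. discrete_moment r (dilate k P) v = poly (ehrhart_polynomial r P v) (real k)"
    unfolding ehrhart_polynomial_def
    by (rule someI[of "\<lambda>p. \<forall>k\<ge>1. discrete_moment r (dilate k P) v = poly p (real k)" p])
      (use assms in simp)
  then show ?thesis using assms by (intro poly_eqI_positive_nats) simp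
qed

lemma ehrhart_polynomial:
  fixes P :: "(real^'n::finite) set"
  assumes "P \<in> lattice_polytopes"
  shows degree_ehrhart_polynomial: "degree (ehrhart_polynomial r P v) \<le> CARD('n) + r"
    and poly_ehrhart_polynomial:
      "1 \<le> k \<or> 1 \<le> r \<Longrightarrow> poly (ehrhart_polynomial r P v) (real k) = discrete_moment r (dilate k P) v"
proof -
  obtain p where p: "degree p \<le> CARD('n) + r"
     "\<And>k. 1 \<le> k \<or> 1 \<le> r \<Longrightarrow> discrete_moment r (dilate k P) v = poly p (real k)"
    using lattice_polytope_moment_polynomial[OF assms, of r v] by (auto simp: polynomial_on_def)
  have eq: "ehrhart_polynomial r P v = p" by (intro ehrhart_polynomial_eqI p(2)) simp
  show "degree (ehrhart_polynomial r P v) \<le> CARD('n) + r"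
    unfolding eq by (rule p(1))
  show "poly (ehrhart_polynomial r P v) (real k) = discrete_moment r (dilate k P) v" if "1 \<le> k \<or> 1 \<le> r"
    unfolding eq by (rule p(2)[OF that, symmetric])
qed

lemma
  fixes A :: "'n::finite tensor"
  assumes "A \<in> sym_tensors r"
  shows sym_tensors_local: "(\<And>i. i < r \<Longrightarrow> v i = w i) \<Longrightarrow> A v = A w"
    and sym_tensors_linear: "i < r \<Longrightarrow> linear (\<lambda>x. A (v(i := x)))"
    and sym_tensors_permute: "\<sigma> permutes {..<r} \<Longrightarrow> A (v \<circ> \<sigma>) = A v"
  using assms unfolding sym_tensors_def mem_Collect_eq by blast+

lemma coeff_ehrhart_polynomial_sym_tensor:
  assumes P: "P \<in> lattice_polytopes"
  shows "(\<lambda>v. coeff (ehrhart_polynomial r P v) i) \<in> sym_tensors r"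
  unfolding sym_tensors_def
proof (intro CollectI conjI allI impI)
  note local = sym_tensors_local[OF discrete_moment_sym_tensor]
    and lin = sym_tensors_linear[OF discrete_moment_sym_tensor]
    and sym = sym_tensors_permute[OF discrete_moment_sym_tensor]
  fix v w :: "nat \<Rightarrow> real^'a"
  {
    assume "\<forall>j<r. v j = w j"
    then have "discrete_moment r X v = discrete_moment r X w" for X
      by (intro local) auto
    then show "coeff (ehrhart_polynomial r P v) i = coeff (ehrhart_polynomial r P w) i"
      by (simp add: ehrhart_polynomial_def)
  next
    fix j assume "j < r"
    note lin = lin[OF this]
    have "ehrhart_polynomial r P (v(j := y + z)) =
        ehrhart_polynomial r P (v(j := y)) + ehrhart_polynomial r P (v(j := z))" for y z
      by (rule ehrhart_polynomial_eqI) (simp add: poly_ehrhart_polynomial[OF P] linear_add[OF lin])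
    moreover have "ehrhart_polynomial r P (v(j := c *\<^sub>R y)) = smult c (ehrhart_polynomial r P (v(j := y)))" for c y
      by (rule ehrhart_polynomial_eqI) (simp add: poly_ehrhart_polynomial[OF P] linear_scale[OF lin])
    ultimately show "linear (\<lambda>y. coeff (ehrhart_polynomial r P (v(j := y))) i)"
      by (intro linearI) simp_all
  next
    fix \<sigma> :: "nat \<Rightarrow> nat" assume "\<sigma> permutes {..<r}"
    then have "discrete_moment r X (v \<circ> \<sigma>) = discrete_moment r X v" for X by (rule sym)
    then show "coeff (ehrhart_polynomial r P (v \<circ> \<sigma>)) i = coeff (ehrhart_polynomial r P v) i"
      by (simp add: ehrhart_polynomial_def)
  }
qed

lemma valuation_coeff_ehrhart_polynomial: "valuation (\<lambda>P v. coeff (ehrhart_polynomial r P v) i)"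
  unfolding valuation_def
proof (intro conjI allI impI)
  fix v :: "nat \<Rightarrow> real^'a"
  have "ehrhart_polynomial r {} v = 0"
    by (rule ehrhart_polynomial_eqI) (simp add: dilate_def discrete_moment_def)
  then show "coeff (ehrhart_polynomial r {} v) i = 0" by simp
next
  fix P Q :: "(real^'a) set" and v
  assume lp: "P \<in> lattice_polytopes" "Q \<in> lattice_polytopes" "P \<union> Q \<in> lattice_polytopes" "P \<inter> Q \<in> lattice_polytopes"
  have "ehrhart_polynomial r (P \<union> Q) v =
    ehrhart_polynomial r P v + ehrhart_polynomial r Q v - ehrhart_polynomial r (P \<inter> Q) v"
  proof (rule ehrhart_polynomial_eqI)
    fix k :: nat assume k: "1 \<le> k"
    have fin: "finite (dilate k R \<inter> int_lattice)" if "R \<in> lattice_polytopes" for R :: "(real^'a) set"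
      using that unfolding dilate_def lattice_polytopes_def
      by (intro finite_bounded_int_lattice bounded_scaling polytope_imp_bounded) simp
    have "inj_on (\<lambda>x. real k *\<^sub>R x) (P \<union> Q)" using k by (intro inj_onI) simp
    then have eq: "dilate k (P \<inter> Q) \<inter> int_lattice = (dilate k P \<inter> int_lattice) \<inter> (dilate k Q \<inter> int_lattice)"
      "dilate k (P \<union> Q) \<inter> int_lattice = (dilate k P \<inter> int_lattice) \<union> (dilate k Q \<inter> int_lattice)"
      by (auto simp: dilate_def image_Un inj_on_image_Int)
    let ?s = "\<lambda>R. \<Sum>x\<in>R. tensor_power x r v"
    have "?s (dilate k (P \<union> Q) \<inter> int_lattice) = ?s (dilate k P \<inter> int_lattice) +
        ?s (dilate k Q \<inter> int_lattice) - ?s (dilate k (P \<inter> Q) \<inter> int_lattice)"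
      unfolding eq using sum.union_inter[OF fin[OF lp(1)] fin[OF lp(2)], of "\<lambda>x. tensor_power x r v"] by linarith
    then show "discrete_moment r (dilate k (P \<union> Q)) v = poly (ehrhart_polynomial r P v +
        ehrhart_polynomial r Q v - ehrhart_polynomial r (P \<inter> Q) v) (real k)"
      using k lp by (simp add: poly_ehrhart_polynomial discrete_moment_def add_divide_distrib diff_divide_distrib)
  qed
  then show "coeff (ehrhart_polynomial r P v) i + coeff (ehrhart_polynomial r Q v) i =
    coeff (ehrhart_polynomial r (P \<union> Q) v) i + coeff (ehrhart_polynomial r (P \<inter> Q) v) i" by simp
qed

lemma det_Ints:
  fixes A :: "real^'n^'n"
  assumes "\<And>i j. A $ i $ j \<in> \<int>"
  shows "det A \<in> \<int>"
  unfolding det_def using assms by (intro Ints_sum Ints_mult Ints_prod) (auto simp: sign_def)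

text \<open>
  By Cramer's rule the entries of \<open>x\<close> are determinants of integer matrices, because the determinant of
  \<open>\<phi>\<close> is 1.
\<close>

lemma SL_int_vector_in_int_lattice_iff:
  fixes \<phi> :: "real^'n^'n"
  assumes "\<phi> \<in> SL_int"
  shows "\<phi> *v x \<in> int_lattice \<longleftrightarrow> x \<in> int_lattice"
proof
  have int: "\<phi> $ i $ j \<in> \<int>" and det: "det \<phi> = 1" for i j using assms by (auto simp: SL_int_def)
  show "\<phi> *v x \<in> int_lattice" if "x \<in> int_lattice"
    using that int by (auto simp: int_lattice_def matrix_vector_mult_def intro!: Ints_sum Ints_mult)
  show "x \<in> int_lattice" if "\<phi> *v x \<in> int_lattice"
  proof -
    define b where "b = \<phi> *v x"
    have "x = (\<chi> k. det (\<chi> i j. if j = k then b $ i else \<phi> $ i $ j) / det \<phi>)"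
      using cramer[of \<phi> x b] det by (simp add: b_def)
    then have "x $ k = det (\<chi> i j. if j = k then b $ i else \<phi> $ i $ j)" for k
      using det by simp
    moreover have "det (\<chi> i j. if j = k then b $ i else \<phi> $ i $ j) \<in> \<int>" for k
      using that int by (intro det_Ints) (simp add: int_lattice_def b_def)
    ultimately show ?thesis by (simp add: int_lattice_def)
  qed
qed

lemma discrete_moment_SL_int:
  assumes "\<phi> \<in> SL_int"
  shows "discrete_moment r ((\<lambda>x. \<phi> *v x) ` X) v = discrete_moment r X (\<lambda>i. transpose \<phi> *v v i)"
proof -
  have "(\<lambda>x. \<phi> *v x) ` X \<inter> int_lattice = (\<lambda>x. \<phi> *v x) ` (X \<inter> int_lattice)"
    using SL_int_vector_in_int_lattice_iff[OF assms] by auto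
  moreover have "inj ((*v) \<phi>)"
    using assms by (intro inj_matrix_vector_mult) (simp add: SL_int_def invertible_det_nz)
  moreover have "(\<phi> *v x) \<bullet> w = x \<bullet> (transpose \<phi> *v w)" for x w
    by (metis dot_lmul_matrix inner_commute transpose_matrix_vector)
  ultimately show ?thesis
    by (simp add: discrete_moment_def tensor_power_def sum.reindex inj_on_subset[of _ UNIV])
qed

lemma SL_equivariant_coeff_ehrhart_polynomial:
  "SL_equivariant (\<lambda>P v. coeff (ehrhart_polynomial r P v) i)"
  unfolding SL_equivariant_def
proof (intro ballI allI)
  fix \<phi> :: "real^'a^'a" and P :: "(real^'a) set" and v assume \<phi>: "\<phi> \<in> SL_int" and P: "P \<in> lattice_polytopes"
  have "dilate k ((\<lambda>x. \<phi> *v x) ` P) = (\<lambda>x. \<phi> *v x) ` dilate k P" for k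
    by (simp add: dilate_def image_image matrix_vector_mult_scaleR)
  then have "ehrhart_polynomial r ((\<lambda>x. \<phi> *v x) ` P) v = ehrhart_polynomial r P (\<lambda>i. transpose \<phi> *v v i)"
    by (intro ehrhart_polynomial_eqI) (simp add: discrete_moment_SL_int[OF \<phi>] poly_ehrhart_polynomial[OF P])
  then show "coeff (ehrhart_polynomial r ((\<lambda>x. \<phi> *v x) ` P) v) i =
    coeff (ehrhart_polynomial r P (\<lambda>i. transpose \<phi> *v v i)) i" by simp
qed

text \<open>
  Evaluating at \<open>k m\<close> instead of \<open>k\<close> scales the \<open>i\<close>-th coefficient by \<open>m\<^sup>i\<close>. For
  \<open>m = 0\<close> this uses the value at 0, hence \<open>r \<ge> 1\<close>.
\<close>

lemma homogeneous_coeff_ehrhart_polynomial: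
  assumes "1 \<le> r"
  shows "homogeneous i (\<lambda>P v. coeff (ehrhart_polynomial r P v) i)"
  unfolding homogeneous_def
proof (intro ballI allI)
  fix m and P :: "(real^'a) set" and v assume P: "P \<in> lattice_polytopes"
  have "ehrhart_polynomial r (dilate m P) v = pcompose (ehrhart_polynomial r P v) [:0, real m:]"
    using poly_ehrhart_polynomial[OF P, of "_ * m" r v] assms
    by (intro ehrhart_polynomial_eqI) (simp add: dilate_dilate poly_pcompose)
  then show "coeff (ehrhart_polynomial r (dilate m P) v) i = real m ^ i * coeff (ehrhart_polynomial r P v) i"
    by (simp add: coeff_pcompose_linear)
qed

lemma ehrhart_polynomial_translate:
  assumes P: "P \<in> lattice_polytopes" and y: "y \<in> int_lattice"
  shows "ehrhart_polynomial r ((\<lambda>x. x + y) ` P) v =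
    (\<Sum>j\<le>r. smult (1 / (fact r * fact j)) (\<Sum>\<sigma> | \<sigma> permutes {..<r}.
       monom (tensor_power y j (\<lambda>i. v (\<sigma> (r - j + i)))) j * ehrhart_polynomial (r - j) P (\<lambda>i. v (\<sigma> i))))"
proof (rule ehrhart_polynomial_eqI)
  fix k :: nat assume k: "1 \<le> k"
  have dil: "dilate k ((\<lambda>x. x + y) ` P) = (\<lambda>x. x + real k *\<^sub>R y) ` dilate k P"
    by (simp add: dilate_def image_image scaleR_add_right)
  have pow: "tensor_power (real k *\<^sub>R y) j w = real k ^ j * tensor_power y j w" for j w
    by (simp add: tensor_power_def prod.distrib)
  have "real k *\<^sub>R y \<in> int_lattice" using y by (intro int_lattice_scale) auto
  then show "discrete_moment r (dilate k ((\<lambda>x. x + y) ` P)) v =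
    poly (\<Sum>j\<le>r. smult (1 / (fact r * fact j)) (\<Sum>\<sigma> | \<sigma> permutes {..<r}.
       monom (tensor_power y j (\<lambda>i. v (\<sigma> (r - j + i)))) j * ehrhart_polynomial (r - j) P (\<lambda>i. v (\<sigma> i)))) (real k)"
    unfolding dil discrete_moment_translate[OF \<open>real k *\<^sub>R y \<in> int_lattice\<close>] poly_sum poly_smult
    by (intro sum.cong refl)
      (simp add: sym_product_def pow poly_sum poly_monom poly_ehrhart_polynomial[OF P disjI1[OF k]] sum_divide_distrib mult_ac)
qed

text \<open>
  In \<open>ehrhart_polynomial_translate\<close> the \<open>j\<close>-th term carries the factor \<open>k\<^sup>j\<close>, so its
  contribution to \<open>k\<^sup>i\<close> is the coefficient of \<open>k\<^bsup>i - j\<^esup>\<close> for rank \<open>r - j\<close>, and zero when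
  \<open>j > i\<close>.
\<close>

lemma translation_covariant_coeff_ehrhart_polynomial:
  "translation_covariant r (\<lambda>P v. coeff (ehrhart_polynomial r P v) i)"
  unfolding translation_covariant_def
proof (intro exI conjI allI impI ballI)
  let ?Y = "\<lambda>s P v. if r - s \<le> i then coeff (ehrhart_polynomial s P v) (i - (r - s)) else 0"
  fix j :: nat assume "j \<le> r"
  have "(\<lambda>_. 0) \<in> sym_tensors j" by (simp add: sym_tensors_def linear_zero)
  then show "?Y j \<in> lattice_polytopes \<rightarrow> sym_tensors j"
    using coeff_ehrhart_polynomial_sym_tensor by (cases "r - j \<le> i") auto
next
  let ?Y = "\<lambda>s P v. if r - s \<le> i then coeff (ehrhart_polynomial s P v) (i - (r - s)) else 0"
  fix y :: "real^'a" and P v assume y: "y \<in> int_lattice" and P: "(P :: (real^'a) set) \<in> lattice_polytopes"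
  show "coeff (ehrhart_polynomial r ((\<lambda>x. x + y) ` P) v) i =
     (\<Sum>j\<le>r. sym_product (r - j) j (?Y (r - j) P) (tensor_power y j) v / fact j)"
    unfolding ehrhart_polynomial_translate[OF P y] coeff_sum coeff_smult coeff_monom_mult
    by (intro sum.cong refl) (auto simp: sym_product_def sum_divide_distrib mult_ac intro!: sum.cong)
qed

theorem theorem1:
  fixes r :: nat
  assumes "r \<ge> 1"
  shows "\<exists>L :: nat \<Rightarrow> (real^'n::finite) set \<Rightarrow> 'n tensor.
    (\<forall>i\<in>{1..CARD('n) + r}. L i \<in> lattice_polytopes \<rightarrow> sym_tensors r) \<and>
    (\<forall>k. \<forall>P\<in>lattice_polytopes. \<forall>v.
       discrete_moment r (dilate k P) v = (\<Sum>i = 1..CARD('n) + r. L i P v * real k ^ i)) \<and>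
    (\<forall>i\<in>{1..CARD('n) + r}.
       valuation (L i) \<and> SL_equivariant (L i) \<and>
       translation_covariant r (L i) \<and> homogeneous i (L i))"
proof (intro exI[of _ "\<lambda>i P v. coeff (ehrhart_polynomial r P v) i"] conjI ballI allI)
  fix i
  show "(\<lambda>P v. coeff (ehrhart_polynomial r P v) i) \<in> lattice_polytopes \<rightarrow> sym_tensors r"
    using coeff_ehrhart_polynomial_sym_tensor by blast
next
  fix k and P :: "(real^'n) set" and v assume P: "P \<in> lattice_polytopes"
  let ?p = "ehrhart_polynomial r P v"
  have "tensor_power (0 :: real^'n) r v = 0" using assms by (simp add: tensor_power_def)
  then have "discrete_moment r (dilate 0 P) v = 0"
    by (auto simp: discrete_moment_def dilate_def intro!: sum.neutral)
  then have "coeff ?p 0 = 0"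
    using poly_ehrhart_polynomial[OF P, of 0 r v] assms by (simp add: poly_0_coeff_0)
  have "discrete_moment r (dilate k P) v = poly ?p (real k)"
    using poly_ehrhart_polynomial[OF P, of k r v] assms by simp
  also have "\<dots> = (\<Sum>i\<le>degree ?p. coeff ?p i * real k ^ i)" by (rule poly_altdef)
  also have "\<dots> = (\<Sum>i\<le>CARD('n) + r. coeff ?p i * real k ^ i)"
    using degree_ehrhart_polynomial[OF P, of r v] by (intro sum.mono_neutral_left) (auto simp: coeff_eq_0)
  also have "\<dots> = (\<Sum>i = 1..CARD('n) + r. coeff ?p i * real k ^ i)"
    using \<open>coeff ?p 0 = 0\<close> by (intro sum.mono_neutral_right) (auto simp: not_less_eq_eq)
  finally show "discrete_moment r (dilate k P) v = (\<Sum>i = 1..CARD('n) + r. coeff ?p i * real k ^ i)" .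
qed (use assms valuation_coeff_ehrhart_polynomial SL_equivariant_coeff_ehrhart_polynomial
    translation_covariant_coeff_ehrhart_polynomial homogeneous_coeff_ehrhart_polynomial in blast)+

end
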